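(* Let $X$ be a finite connected simplicial complex with basepoint $x_0$. There is a homeomorphism $S(X)\cong\omega(X)$ between the combinatorial space $S(X)$ and the space $\omega(X)$ of thin PL loops.
   Context: $I=[0,1]$. $X$ is embedded in some $\mathbb{R}^N$ so that all its faces are affine simplices; $x_0$ is the basepoint. The space $S(X)$: for $k\ge 0$ let $\tilde S_k\subset X^{k+1}$ be the space of tuples $(x_0,x_1,\dots,x_k)$, with first entry the basepoint $x_0$, such that $x_k=x_0$ and $x_i,x_{i+1}$ lie in the same simplex of $X$ for every $i$. Let $\approx$ be the equivalence relation generated by $(x_0,\dots,x_{i-1},x_i,x_{i+1},\dots,x_k)\approx(x_0,\dots,x_{i-1},\hat x_i,x_{i+1},\dots,x_k)$ (the entry $x_i$ is deleted, $0<i<k$) whenever $x_{i-1},x_i,x_{i+1}$ are aligned (lie on a common line) within the same simplex, together with $(x_0,x_0)\approx(x_0)$. Put $S_n(X)=\coprod_{0\le k\le n}\tilde S_k/_\approx$ with the quotient topology, and $S(X)=\bigcup_n S_n(X)=\coprod_k\tilde S_k/_\approx$ with the colimit topology. The space $\omega(X)$: a path $\gamma:I\to X$ is PL if the composite $I\to X\subset\mathbb{R}^N$ is piecewise linear; then there is a subdivision $0=t_0<\dots<t_k=1$ such that each $\gamma|_{[t_{i-1},t_i]}$ is affine with image in a single simplex of $X$. $\Omega_{pl}(X)$ is the set of PL loops based at $x_0$. $F_n\Omega_{pl}X$ is the set of such loops that admit a subdivision $0=t_0\le t_1\le\dots\le t_k=1$ with $k\le n$ such that the loop is affine with image in a single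 simplex on each $[t_{i-1},t_i]$, with the sup-metric topology. $\Omega^w_{pl}(X)$ is $\Omega_{pl}(X)=\bigcup_nF_n\Omega_{pl}X$ with the colimit (final) topology. For based loops $f,g$, $f\circ g$ denotes concatenation and $g^{-1}$ the reversed loop. A based PL loop $\gamma$ is thin if there is a homotopy rel basepoint through PL loops from $\gamma$ to the constant loop at $x_0$ whose image is contained in $\gamma(I)$. Two based PL loops $f,g$ are thin homotopic if there is a finite sequence of based PL loops $\gamma_1=f,\dots,\gamma_m=g$ with each $\gamma_i\circ\gamma_{i+1}^{-1}$ thin. $\omega(X)$ is the quotient space of $\Omega^w_{pl}(X)$ by thin homotopy. *)

theory Defs
  imports "HOL-Analysis.Analysis"
begin

section \<open>Quotient and colimit topologies\<close>

text \<open>Points of the quotient are the classes \<open>R `` {x}\<close>. The relation \<open>R\<close> is not required to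
  live on \<open>topspace T\<close>, so the quotient of a subspace by the same \<open>R\<close> has its points among
  those of the big quotient.\<close>

definition quotient_topology :: "'a topology \<Rightarrow> ('a \<times> 'a) set \<Rightarrow> 'a set topology" where
  "quotient_topology T R =
     topology (\<lambda>U. U \<subseteq> topspace T // R \<and> openin T {x \<in> topspace T. R `` {x} \<in> U})"

lemma openin_quotient_topology:
  "openin (quotient_topology T R) U \<longleftrightarrow>
     U \<subseteq> topspace T // R \<and> openin T {x \<in> topspace T. R `` {x} \<in> U}"
proof -
  have "istopology (\<lambda>U. U \<subseteq> topspace T // R \<and> openin T {x \<in> topspace T. R `` {x} \<in> U})"
    unfolding istopology_def
  proof (intro conjI allI impI)
    fix U V
    assume "U \<subseteq> topspace T // R \<and> openin T {x \<in> topspace T. R `` {x} \<in> U}"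
      and "V \<subseteq> topspace T // R \<and> openin T {x \<in> topspace T. R `` {x} \<in> V}"
    moreover have "{x \<in> topspace T. R `` {x} \<in> U \<inter> V} =
        {x \<in> topspace T. R `` {x} \<in> U} \<inter> {x \<in> topspace T. R `` {x} \<in> V}"
      by auto
    ultimately show "U \<inter> V \<subseteq> topspace T // R"
      and "openin T {x \<in> topspace T. R `` {x} \<in> U \<inter> V}"
      by auto
  next
    fix \<U>
    assume *: "\<forall>U\<in>\<U>. U \<subseteq> topspace T // R \<and> openin T {x \<in> topspace T. R `` {x} \<in> U}"
    then show "\<Union>\<U> \<subseteq> topspace T // R"
      by auto
    have "{x \<in> topspace T. R `` {x} \<in> \<Union>\<U>} = (\<Union>U\<in>\<U>. {x \<in> topspace T. R `` {x} \<in> U})"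
      by auto
    with * show "openin T {x \<in> topspace T. R `` {x} \<in> \<Union>\<U>}"
      by auto
  qed
  then show ?thesis
    by (simp add: quotient_topology_def)
qed

lemma topspace_quotient_topology [simp]:
  "topspace (quotient_topology T R) = topspace T // R"
proof
  have "openin (quotient_topology T R) (topspace (quotient_topology T R))"
    by (rule openin_topspace)
  then show "topspace (quotient_topology T R) \<subseteq> topspace T // R"
    unfolding openin_quotient_topology by (rule conjunct1)
  have "{x \<in> topspace T. R `` {x} \<in> topspace T // R} = topspace T"
    by (auto intro: quotientI)
  then have "openin (quotient_topology T R) (topspace T // R)"
    by (simp add: openin_quotient_topology)
  then show "topspace T // R \<subseteq> topspace (quotient_topology T R)"
    by (rule openin_subset)
qed

text \<open>The final topology on \<open>A\<close> with respect to the inclusions \<open>topspace (T n) \<subseteq> A\<close>. In the uses below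
  the \<open>T n\<close> exhaust \<open>A\<close>.\<close>

definition colimit_topology :: "'a set \<Rightarrow> (nat \<Rightarrow> 'a topology) \<Rightarrow> 'a topology" where
  "colimit_topology A T =
     topology (\<lambda>U. U \<subseteq> A \<and> (\<forall>n. openin (T n) (U \<inter> topspace (T n))))"

lemma openin_colimit_topology:
  "openin (colimit_topology A T) U \<longleftrightarrow>
     U \<subseteq> A \<and> (\<forall>n. openin (T n) (U \<inter> topspace (T n)))"
proof -
  have "istopology (\<lambda>U. U \<subseteq> A \<and> (\<forall>n. openin (T n) (U \<inter> topspace (T n))))"
    unfolding istopology_def
  proof (intro conjI allI impI)
    fix U V n
    assume "U \<subseteq> A \<and> (\<forall>n. openin (T n) (U \<inter> topspace (T n)))"
      and "V \<subseteq> A \<and> (\<forall>n. openin (T n) (V \<inter> topspace (T n)))"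
    moreover have "U \<inter> V \<inter> topspace (T n) = (U \<inter> topspace (T n)) \<inter> (V \<inter> topspace (T n))"
      by auto
    ultimately show "U \<inter> V \<subseteq> A" and "openin (T n) (U \<inter> V \<inter> topspace (T n))"
      by auto
  next
    fix \<U> n
    assume *: "\<forall>U\<in>\<U>. U \<subseteq> A \<and> (\<forall>n. openin (T n) (U \<inter> topspace (T n)))"
    then show "\<Union>\<U> \<subseteq> A"
      by auto
    have "\<Union>\<U> \<inter> topspace (T n) = (\<Union>U\<in>\<U>. U \<inter> topspace (T n))"
      by auto
    moreover have "openin (T n) (\<Union>U\<in>\<U>. U \<inter> topspace (T n))"
      using * by (intro openin_Union) auto
    ultimately show "openin (T n) (\<Union>\<U> \<inter> topspace (T n))"
      by simp
  qed
  then show ?thesis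
    by (simp add: colimit_topology_def)
qed

lemma topspace_colimit_topology:
  assumes "\<And>n. topspace (T n) \<subseteq> A"
  shows "topspace (colimit_topology A T) = A"
proof
  have "openin (colimit_topology A T) (topspace (colimit_topology A T))"
    by (rule openin_topspace)
  then show "topspace (colimit_topology A T) \<subseteq> A"
    unfolding openin_colimit_topology by (rule conjunct1)
  have "A \<inter> topspace (T n) = topspace (T n)" for n
    using assms by auto
  then have "openin (colimit_topology A T) A"
    by (simp add: openin_colimit_topology)
  then show "A \<subseteq> topspace (colimit_topology A T)"
    by (rule openin_subset)
qed


section \<open>The combinatorial space \<open>S(X)\<close>\<close>

text \<open>Throughout, \<open>X = \<Union>C\<close> for a geometric simplicial complex \<open>C\<close> (the set of closed simplices).
  A tuple \<open>(x\<^sub>0, \<dots>, x\<^sub>k)\<close> is an extensional function on \<open>{..k}\<close>; in the disjoint union over \<open>k\<close>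
  it is tagged as the pair \<open>(k, x)\<close>.\<close>

definition tuples :: "'a::euclidean_space set set \<Rightarrow> 'a \<Rightarrow> nat \<Rightarrow> (nat \<Rightarrow> 'a) set" where
  "tuples C x0 k =
     {x \<in> {..k} \<rightarrow>\<^sub>E \<Union>C. x 0 = x0 \<and> x k = x0 \<and> (\<forall>i<k. \<exists>S\<in>C. x i \<in> S \<and> x (Suc i) \<in> S)}"

definition tuple_space :: "'a::euclidean_space set set \<Rightarrow> 'a \<Rightarrow> nat \<Rightarrow> (nat \<Rightarrow> 'a) topology" where
  "tuple_space C x0 k =
     subtopology (product_topology (\<lambda>_. top_of_set (\<Union>C)) {..k}) (tuples C x0 k)"

definition delete_entry :: "nat \<Rightarrow> nat \<Rightarrow> (nat \<Rightarrow> 'a) \<Rightarrow> (nat \<Rightarrow> 'a)" where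
  "delete_entry k i x = (\<lambda>j\<in>{..k - 1}. if j < i then x j else x (Suc j))"

inductive tuple_step ::
    "'a::euclidean_space set set \<Rightarrow> 'a \<Rightarrow> nat \<times> (nat \<Rightarrow> 'a) \<Rightarrow> nat \<times> (nat \<Rightarrow> 'a) \<Rightarrow> bool"
  for C x0 where
  delete: "\<lbrakk>x \<in> tuples C x0 k; 0 < i; i < k; S \<in> C;
            x (i - 1) \<in> S; x i \<in> S; x (i + 1) \<in> S; collinear {x (i - 1), x i, x (i + 1)}\<rbrakk>
           \<Longrightarrow> tuple_step C x0 (k, x) (k - 1, delete_entry k i x)"
| trivial: "tuple_step C x0 (1, \<lambda>j\<in>{..1}. x0) (0, \<lambda>j\<in>{..0}. x0)"

definition tuple_rel ::
    "'a::euclidean_space set set \<Rightarrow> 'a \<Rightarrow> ((nat \<times> (nat \<Rightarrow> 'a)) \<times> (nat \<times> (nat \<Rightarrow> 'a))) set" where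
  "tuple_rel C x0 = {(p, q). equivclp (tuple_step C x0) p q}"

definition S_filt ::
    "'a::euclidean_space set set \<Rightarrow> 'a \<Rightarrow> nat \<Rightarrow> (nat \<times> (nat \<Rightarrow> 'a)) set topology" where
  "S_filt C x0 n = quotient_topology (sum_topology (tuple_space C x0) {..n}) (tuple_rel C x0)"

definition S_space ::
    "'a::euclidean_space set set \<Rightarrow> 'a \<Rightarrow> (nat \<times> (nat \<Rightarrow> 'a)) set topology" where
  "S_space C x0 = colimit_topology (\<Union>n. topspace (S_filt C x0 n)) (S_filt C x0)"

lemma topspace_tuple_space [simp]: "topspace (tuple_space C x0 k) = tuples C x0 k"
  by (auto simp: tuple_space_def tuples_def)

lemma topspace_S_space:
  "topspace (S_space C x0) = (SIGMA k:UNIV. tuples C x0 k) // tuple_rel C x0"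
proof -
  have "topspace (S_space C x0) = (\<Union>n. (SIGMA k:{..n}. tuples C x0 k) // tuple_rel C x0)"
    unfolding S_space_def S_filt_def
    by (subst topspace_colimit_topology) (auto simp: comp_def)
  also have "\<dots> = (\<Union>n. SIGMA k:{..n}. tuples C x0 k) // tuple_rel C x0"
    by (simp add: quotient_def)
  also have "(\<Union>n. SIGMA k:{..n}. tuples C x0 k) = (SIGMA k:UNIV. tuples C x0 k)"
    by auto
  finally show ?thesis .
qed


section \<open>The space \<open>\<omega>(X)\<close> of PL loops up to thin homotopy\<close>

definition affine_on_interval :: "real \<Rightarrow> real \<Rightarrow> (real \<Rightarrow> 'a::real_vector) \<Rightarrow> bool" where
  "affine_on_interval a b \<gamma> \<longleftrightarrow> (\<exists>p v. \<forall>t\<in>{a..b}. \<gamma> t = p + t *\<^sub>R v)"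

definition piecewise_linear_path :: "(real \<Rightarrow> 'a::euclidean_space) \<Rightarrow> bool" where
  "piecewise_linear_path \<gamma> \<longleftrightarrow> path \<gamma> \<and>
     (\<exists>k t. t 0 = 0 \<and> t k = 1 \<and>
        (\<forall>i<k. t i < t (Suc i) \<and> affine_on_interval (t i) (t (Suc i)) \<gamma>))"

text \<open>Loops are extensional functions on \<open>{0..1}\<close>. The library operations \<open>+++\<close> and \<open>reversepath\<close>
  preserve extensionality, so no restriction is needed when they are used below.\<close>

definition pl_loops :: "'a::euclidean_space set set \<Rightarrow> 'a \<Rightarrow> (real \<Rightarrow> 'a) set" where
  "pl_loops C x0 =
     {\<gamma> \<in> {0..1} \<rightarrow>\<^sub>E \<Union>C. piecewise_linear_path \<gamma> \<and> pathstart \<gamma> = x0 \<and> pathfinish \<gamma> = x0}"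

definition pl_loops_filt ::
    "'a::euclidean_space set set \<Rightarrow> 'a \<Rightarrow> nat \<Rightarrow> (real \<Rightarrow> 'a) set" where
  "pl_loops_filt C x0 n =
     {\<gamma> \<in> pl_loops C x0. \<exists>k\<le>n. \<exists>t. t 0 = 0 \<and> t k = 1 \<and>
        (\<forall>i<k. t i \<le> t (Suc i) \<and> affine_on_interval (t i) (t (Suc i)) \<gamma> \<and>
           (\<exists>S\<in>C. \<gamma> ` {t i..t (Suc i)} \<subseteq> S))}"

text \<open>The metric of \<open>cfunspace\<close> is the supremum metric.\<close>

definition pl_filt_topology ::
    "'a::euclidean_space set set \<Rightarrow> 'a \<Rightarrow> nat \<Rightarrow> (real \<Rightarrow> 'a) topology" where
  "pl_filt_topology C x0 n =
     subtopology (mtopology_of (cfunspace (top_of_set {0..1}) euclidean_metric))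
       (pl_loops_filt C x0 n)"

definition weak_pl_loops :: "'a::euclidean_space set set \<Rightarrow> 'a \<Rightarrow> (real \<Rightarrow> 'a) topology" where
  "weak_pl_loops C x0 = colimit_topology (pl_loops C x0) (pl_filt_topology C x0)"

text \<open>Membership in \<open>pl_loops C x0\<close> is imposed on every stage of the homotopy, which therefore
  is one through based PL loops; its image lies in \<open>path_image \<gamma>\<close>.\<close>

definition thin :: "'a::euclidean_space set set \<Rightarrow> 'a \<Rightarrow> (real \<Rightarrow> 'a) \<Rightarrow> bool" where
  "thin C x0 \<gamma> \<longleftrightarrow>
     homotopic_with_canon (\<lambda>h. h \<in> pl_loops C x0) {0..1} (path_image \<gamma>) \<gamma> (\<lambda>t\<in>{0..1}. x0)"

definition thin_homotopic ::
    "'a::euclidean_space set set \<Rightarrow> 'a \<Rightarrow> (real \<Rightarrow> 'a) \<Rightarrow> (real \<Rightarrow> 'a) \<Rightarrow> bool" where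
  "thin_homotopic C x0 f g \<longleftrightarrow>
     (\<exists>m c. (\<forall>i\<le>m. c i \<in> pl_loops C x0) \<and> c 0 = f \<and> c m = g \<and>
        (\<forall>i<m. thin C x0 (c i +++ reversepath (c (Suc i)))))"

definition omega_space :: "'a::euclidean_space set set \<Rightarrow> 'a \<Rightarrow> (real \<Rightarrow> 'a) set topology" where
  "omega_space C x0 =
     quotient_topology (weak_pl_loops C x0) {(f, g). thin_homotopic C x0 f g}"

lemma topspace_pl_filt_topology [simp]:
  "topspace (pl_filt_topology C x0 n) = pl_loops_filt C x0 n"
proof -
  have "\<gamma> \<in> mspace (cfunspace (top_of_set {0..1}) euclidean_metric)"
    if "\<gamma> \<in> pl_loops_filt C x0 n" for \<gamma>
  proof -
    have "path \<gamma>" and ext: "\<gamma> \<in> extensional {0..1}"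
      using that by (auto simp: pl_loops_filt_def pl_loops_def piecewise_linear_path_def PiE_def)
    then have "continuous_map (top_of_set {0..1}) euclidean \<gamma>"
      by (simp add: path_def)
    moreover have "compactin (top_of_set {0..1::real}) (topspace (top_of_set {0..1}))"
      by (simp add: compactin_subtopology)
    ultimately show ?thesis
      using ext by (subst compactin_mspace_cfunspace) auto
  qed
  then show ?thesis
    by (auto simp: pl_filt_topology_def)
qed

lemma topspace_weak_pl_loops [simp]: "topspace (weak_pl_loops C x0) = pl_loops C x0"
  unfolding weak_pl_loops_def
  by (rule topspace_colimit_topology) (auto simp: pl_loops_filt_def)

lemma extensional_joinpaths:
  "f \<in> extensional {0..1} \<Longrightarrow> g \<in> extensional {0..1} \<Longrightarrow> f +++ g \<in> extensional {0..1}"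
  by (auto simp: extensional_def joinpaths_def)

lemma extensional_reversepath:
  "f \<in> extensional {0..1} \<Longrightarrow> reversepath f \<in> extensional {0..1}"
  by (auto simp: extensional_def reversepath_def)

end

theory Submission
  imports Defs
begin

text \<open>A tuple \<open>(x\<^sub>0, \<dots>, x\<^sub>k)\<close> is sent to the polygonal loop through \<open>x\<^sub>i\<close> at time \<open>i / k\<close>, and a PL loop to
  the tuple of its values at the points of a subdivision that is fine enough for each piece to be affine
  and to stay in one cell. Modulo the two equivalence relations these maps are well defined and mutually
  inverse, and both are continuous.

  The vertex tuple does not depend on the subdivision, because refining a piece only inserts points of a
  segment lying in a single cell (\<open>traverses_unique\<close>). Conversely, deleting an aligned point \<open>x\<^sub>i\<close> amounts
  to sliding \<open>x\<^sub>i\<close> to \<open>x\<^bsub>i - 1\<^esub>\<close> inside the old polygon and then changing the parametrisation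
  (\<open>tuple_step_thin_homotopic\<close>). Both are homotopies inside the image of one of the two loops, and a
  homotopy \<open>f \<simeq> g\<close> inside the image of \<open>f\<close> makes \<open>f \<circ> g\<inverse>\<close> thin: deform \<open>g\<inverse>\<close> back to \<open>f\<inverse>\<close>, then retract \<open>f \<circ> f\<inverse>\<close> along
  itself (\<open>thin_join_reverse\<close>). The polygon through the vertices of a PL loop is a
  reparametrisation of that loop.

  The essential point is that a thin loop \<open>\<gamma>\<close> has a trivial vertex tuple (\<open>thin_imp_trivial\<close>). The homotopy
  runs through PL loops in the graph \<open>\<gamma>(I)\<close>, a finite union of segments, so it suffices that PL loops in
  a fixed graph which are uniformly close have equivalent vertex tuples (\<open>nearby_paths_eqv\<close>); then the class
  is locally constant, hence constant, along the homotopy. Near a point \<open>p\<close> the graph consists of segments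
  through \<open>p\<close>, so a PL path from \<open>a\<close> to \<open>b\<close> near \<open>p\<close> is equivalent to \<open>(a, p, b)\<close>: insert \<open>p\<close> in every piece
  and cancel the excursions away from \<open>p\<close> (\<open>traverses_star\<close>). Two close loops visit the same sequence of
  such stars and differ only by moves along single segments. Finally, if \<open>f \<circ> g\<inverse>\<close> is thin then the vertex
  tuples of \<open>f\<close> and \<open>g\<close> agree by cancellation, as in a group.

  The polygon depends linearly on its vertices, which gives continuity in one direction. In the other
  direction a subdivision cannot be chosen continuously, but subdivisions into \<open>n\<close> pieces form a compact
  set: along a convergent sequence of loops the subdivisions subconverge, and their limit is a subdivision
  of the limit loop (\<open>openin_vertex_tuple_preimage\<close>).\<close>

section \<open>Lists of points up to elementary moves\<close>

text \<open>The relation on tuples, transported to lists so that it becomes a congruence for concatenation. Paths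
  with arbitrary end points are allowed, and any entry may be repeated; on lists that come from loops the
  additional moves are consequences of the moves on tuples.\<close>

inductive list_move :: "'a::euclidean_space set set \<Rightarrow> 'a list \<Rightarrow> 'a list \<Rightarrow> bool" for C where
  aligned: "\<lbrakk>S \<in> C; {a, b, c} \<subseteq> S; collinear {a, b, c}\<rbrakk>
    \<Longrightarrow> list_move C (us @ [a, b, c] @ vs) (us @ [a, c] @ vs)"
| repeated: "list_move C (us @ [a, a] @ vs) (us @ [a] @ vs)"

definition list_eqv :: "'a::euclidean_space set set \<Rightarrow> 'a list \<Rightarrow> 'a list \<Rightarrow> bool" where
  "list_eqv C = equivclp (list_move C)"

lemma list_eqv_refl [simp, intro]: "list_eqv C xs xs"
  by (simp add: list_eqv_def)

lemma list_eqv_sym: "list_eqv C xs ys \<Longrightarrow> list_eqv C ys xs"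
  unfolding list_eqv_def by (rule equivclp_sym)

lemma list_eqv_trans [trans]: "list_eqv C xs ys \<Longrightarrow> list_eqv C ys zs \<Longrightarrow> list_eqv C xs zs"
  unfolding list_eqv_def by (meson equivp_evquivclp equivp_transp)

lemma list_move_context: "list_move C xs ys \<Longrightarrow> list_move C (us @ xs @ vs) (us @ ys @ vs)"
proof (induction rule: list_move.induct)
  case (aligned S a b c us' vs')
  then show ?case
    using list_move.aligned[of S C a b c "us @ us'" "vs' @ vs"] by simp
next
  case (repeated us' a vs')
  then show ?case
    using list_move.repeated[of C "us @ us'" a "vs' @ vs"] by simp
qed

lemma list_eqv_context:
  assumes "list_eqv C xs ys"
  shows "list_eqv C (us @ xs @ vs) (us @ ys @ vs)"
  using assms unfolding list_eqv_def
proof (induction rule: equivclp_induct)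
  case base
  then show ?case by simp
next
  case (step y z)
  then show ?case
    by (meson list_move_context equivclp_sym r_into_equivclp equivp_evquivclp equivp_transp)
qed

lemma list_eqv_append:
  assumes "list_eqv C xs xs'" "list_eqv C ys ys'"
  shows "list_eqv C (xs @ ys) (xs' @ ys')"
  using list_eqv_context[OF assms(1), of "[]" ys] list_eqv_context[OF assms(2), of xs' "[]"]
  by (auto intro: list_eqv_trans)

lemma list_eqv_aligned:
  assumes "S \<in> C" "a \<in> S" "b \<in> S" "c \<in> S" "collinear {a, b, c}"
  shows "list_eqv C [a, b, c] [a, c]"
  using list_move.aligned[of S C a b c "[]" "[]"] assms by (auto simp: list_eqv_def)

lemma list_eqv_repeated: "list_eqv C [a, a] [a]"
  using list_move.repeated[of C "[]" a "[]"] by (auto simp: list_eqv_def)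

lemma list_eqv_repeated_append:
  assumes "xs \<noteq> []" "last xs = a"
  shows "list_eqv C (xs @ [a]) xs"
  using list_eqv_context[OF list_eqv_repeated, of C "butlast xs" a "[]"] assms
  by (metis append.assoc append_Cons append_Nil append_butlast_last_id)

lemma list_eqv_repeated_prepend:
  assumes "xs \<noteq> []" "hd xs = a"
  shows "list_eqv C (a # xs) xs"
  using list_eqv_context[OF list_eqv_repeated, of C "[]" a "tl xs"] assms
  by (cases xs) auto

lemma list_eqv_backtrack:
  assumes "S \<in> C" "a \<in> S" "b \<in> S"
  shows "list_eqv C [a, b, a] [a]"
  using list_eqv_aligned[OF assms assms(2)] list_eqv_repeated
  by (metis collinear_2 insert_commute insert_absorb2 list_eqv_trans)

text \<open>The repetition in the middle is what two consecutive pieces of a path leave behind.\<close>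

lemma list_eqv_merge:
  assumes "S \<in> C" "a \<in> S" "b \<in> S" "c \<in> S" "collinear {a, b, c}"
  shows "list_eqv C ([a, b] @ [b, c]) [a, c]"
  using list_eqv_context[OF list_eqv_repeated, of C "[a]" b "[c]"] list_eqv_aligned[OF assms]
  by (auto intro: list_eqv_trans)

definition chain_in :: "'a set set \<Rightarrow> 'a list \<Rightarrow> bool" where
  "chain_in C zs \<longleftrightarrow> zs \<noteq> [] \<and> set zs \<subseteq> \<Union>C \<and> successively (\<lambda>a b. \<exists>S\<in>C. a \<in> S \<and> b \<in> S) zs"

lemma chain_in_Cons:
  "chain_in C (a # zs) \<longleftrightarrow>
     a \<in> \<Union>C \<and> (zs = [] \<or> chain_in C zs \<and> (\<exists>S\<in>C. a \<in> S \<and> hd zs \<in> S))"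
  unfolding chain_in_def by (cases zs) auto

text \<open>The cancellation \<open>g \<circ> g\<inverse> \<approx> 1\<close>, from the turning point outwards.\<close>

lemma list_eqv_reversal:
  assumes "chain_in C zs"
  shows "list_eqv C (zs @ rev zs) [hd zs]"
  using assms
proof (induction zs)
  case Nil
  then show ?case by (simp add: chain_in_def)
next
  case (Cons a zs)
  show ?case
  proof (cases "zs = []")
    case True
    then show ?thesis by (simp add: list_eqv_repeated)
  next
    case False
    with Cons.prems obtain S where S: "chain_in C zs" "S \<in> C" "a \<in> S" "hd zs \<in> S"
      by (auto simp: chain_in_Cons)
    have "list_eqv C ([a] @ (zs @ rev zs) @ [a]) ([a] @ [hd zs] @ [a])"
      by (intro list_eqv_context Cons.IH S)
    also have "list_eqv C ([a] @ [hd zs] @ [a]) [a]"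
      using list_eqv_backtrack S by auto
    finally show ?thesis by simp
  qed
qed

section \<open>Piecewise linear paths\<close>

text \<open>\<open>traverses E f a b zs\<close> records a subdivision of \<open>[a, b]\<close> into affine pieces of \<open>f\<close>, each with image
  in one member of \<open>E\<close>, by the list of vertex values; the value at a joint occurs twice in \<open>zs\<close>. The rule
  for joining is symmetric in its two parts, which makes reversal and cutting uniform. Plain piecewise
  linearity is the case \<open>E = {UNIV}\<close>.\<close>

inductive traverses ::
    "'a::real_vector set set \<Rightarrow> (real \<Rightarrow> 'a) \<Rightarrow> real \<Rightarrow> real \<Rightarrow> 'a list \<Rightarrow> bool"
  for E f where
  piece: "\<lbrakk>a \<le> b; affine_on_interval a b f; S \<in> E; f ` {a..b} \<subseteq> S\<rbrakk> \<Longrightarrow> traverses E f a b [f a, f b]"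
| join: "\<lbrakk>traverses E f a c xs; traverses E f c b ys\<rbrakk> \<Longrightarrow> traverses E f a b (xs @ ys)"

lemma affine_on_interval_iff:
  assumes "a \<le> b"
  shows "affine_on_interval a b f \<longleftrightarrow>
    (\<forall>u\<in>{0..1}. f ((1 - u) * a + u * b) = (1 - u) *\<^sub>R f a + u *\<^sub>R f b)"
proof
  assume "affine_on_interval a b f"
  then obtain p v where pv: "\<And>t. t \<in> {a..b} \<Longrightarrow> f t = p + t *\<^sub>R v"
    by (auto simp: affine_on_interval_def)
  show "\<forall>u\<in>{0..1}. f ((1 - u) * a + u * b) = (1 - u) *\<^sub>R f a + u *\<^sub>R f b"
  proof
    fix u :: real assume "u \<in> {0..1}"
    then have "(1 - u) * a + u * b \<in> {a..b}"
      using assms convexD_alt[of "{a..b}" a b u] by (simp add: algebra_simps)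
    with assms show "f ((1 - u) * a + u * b) = (1 - u) *\<^sub>R f a + u *\<^sub>R f b"
      by (simp add: pv algebra_simps)
  qed
next
  assume *: "\<forall>u\<in>{0..1}. f ((1 - u) * a + u * b) = (1 - u) *\<^sub>R f a + u *\<^sub>R f b"
  show "affine_on_interval a b f"
  proof (cases "a = b")
    case True
    then have "\<forall>t\<in>{a..b}. f t = f a + t *\<^sub>R 0"
      by auto
    then show ?thesis
      unfolding affine_on_interval_def by blast
  next
    case False
    with assms have "a < b" by simp
    define v where "v = (1 / (b - a)) *\<^sub>R (f b - f a)"
    have "f t = (f a - a *\<^sub>R v) + t *\<^sub>R v" if "t \<in> {a..b}" for t
    proof -
      define u where "u = (t - a) / (b - a)"
      have ub: "(b - a) * u = t - a"
        using \<open>a < b\<close> by (simp add: u_def)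
      then have t: "t = (1 - u) * a + u * b"
        by (simp add: algebra_simps)
      have "u \<in> {0..1}"
        using that \<open>a < b\<close> by (auto simp: u_def)
      have "f t = (1 - u) *\<^sub>R f a + u *\<^sub>R f b"
        unfolding t using * \<open>u \<in> {0..1}\<close> by blast
      also have "\<dots> = f a + ((b - a) * u) *\<^sub>R v"
      proof -
        have "(b - a) *\<^sub>R v = f b - f a"
          using \<open>a < b\<close> by (simp add: v_def)
        then have "(u * (b - a)) *\<^sub>R v = u *\<^sub>R (f b - f a)"
          by (metis scaleR_scaleR)
        then show ?thesis
          by (simp add: algebra_simps)
      qed
      also have "(b - a) * u = t - a"
        by (rule ub)
      finally show ?thesis by (simp add: algebra_simps)
    qed
    then show ?thesis
      unfolding affine_on_interval_def by blast
  qed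
qed

lemma affine_on_interval_subset:
  "affine_on_interval a b f \<Longrightarrow> {c..d} \<subseteq> {a..b} \<Longrightarrow> affine_on_interval c d f"
  unfolding affine_on_interval_def by blast

lemma affine_on_interval_collinear:
  assumes "affine_on_interval a b f"
  shows "collinear (f ` {a..b})"
proof -
  obtain p v where "\<And>t. t \<in> {a..b} \<Longrightarrow> f t = p + t *\<^sub>R v"
    using assms by (auto simp: affine_on_interval_def)
  then have "f s - f t = (s - t) *\<^sub>R v" if "s \<in> {a..b}" "t \<in> {a..b}" for s t
    using that by (simp add: algebra_simps)
  then show ?thesis
    unfolding collinear_def by (intro exI[of _ v]) blast
qed

lemma affine_on_interval_image:
  fixes f :: "real \<Rightarrow> 'a::real_normed_vector"
  assumes "affine_on_interval a b f"
  shows "convex (f ` {a..b})" "compact (f ` {a..b})"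
proof -
  obtain p v where pv: "\<And>t. t \<in> {a..b} \<Longrightarrow> f t = p + t *\<^sub>R v"
    using assms by (auto simp: affine_on_interval_def)
  then have eq: "f ` {a..b} = (+) p ` ((\<lambda>t. t *\<^sub>R v) ` {a..b})"
    by (auto simp: image_image)
  show "convex (f ` {a..b})"
    unfolding eq by (intro convex_translation convex_linear_image) (auto simp: linear_iff algebra_simps)
  have "continuous_on {a..b} (\<lambda>t. p + t *\<^sub>R v)"
    by (intro continuous_intros)
  then have "compact ((\<lambda>t. p + t *\<^sub>R v) ` {a..b})"
    by (rule compact_continuous_image) simp
  then show "compact (f ` {a..b})"
    unfolding eq by (simp add: image_image)
qed

lemma affine_on_interval_continuous:
  fixes f :: "real \<Rightarrow> 'a::real_normed_vector"
  assumes "affine_on_interval a b f"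
  shows "continuous_on {a..b} f"
proof -
  obtain p v where pv: "\<And>t. t \<in> {a..b} \<Longrightarrow> f t = p + t *\<^sub>R v"
    using assms by (auto simp: affine_on_interval_def)
  have "continuous_on {a..b} (\<lambda>t. p + t *\<^sub>R v)"
    by (intro continuous_intros)
  then show ?thesis
    using pv by (simp cong: continuous_on_cong_simp)
qed

lemma traverses_le: "traverses E f a b zs \<Longrightarrow> a \<le> b"
  by (induction rule: traverses.induct) auto

lemma traverses_ends:
  "traverses E f a b zs \<Longrightarrow> zs \<noteq> [] \<and> hd zs = f a \<and> last zs = f b"
  by (induction rule: traverses.induct) auto

lemma traverses_continuous:
  fixes f :: "real \<Rightarrow> 'a::real_normed_vector"
  assumes "traverses E f a b zs"
  shows "continuous_on {a..b} f"
  using assms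
proof (induction rule: traverses.induct)
  case (piece a b S)
  then show ?case by (intro affine_on_interval_continuous)
next
  case (join a c xs b ys)
  then have "{a..b} = {a..c} \<union> {c..b}"
    using traverses_le by (metis ivl_disj_un_two_touch(4))
  with join.IH show ?case
    by (simp add: continuous_on_closed_Un)
qed

lemma traverses_image: "traverses E f a b zs \<Longrightarrow> f ` {a..b} \<subseteq> \<Union>E"
proof (induction rule: traverses.induct)
  case (piece a b S)
  then show ?case by blast
next
  case (join a c xs b ys)
  then have "{a..b} = {a..c} \<union> {c..b}"
    using traverses_le by (metis ivl_disj_un_two_touch(4))
  with join.IH show ?case
    by (simp add: image_Un)
qed

lemma traverses_chain: "traverses E f a b zs \<Longrightarrow> chain_in E zs"
proof (induction rule: traverses.induct)
  case (piece a b S)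
  then have "f a \<in> S" "f b \<in> S" by auto
  with piece show ?case by (auto simp: chain_in_def)
next
  case (join a c xs b ys)
  have "last xs = f c" "hd ys = f c" "xs \<noteq> []" "ys \<noteq> []"
    using join.hyps traverses_ends by blast+
  moreover have "f c \<in> \<Union>E"
    using join.IH(2) \<open>hd ys = f c\<close> \<open>ys \<noteq> []\<close> unfolding chain_in_def by (metis hd_in_set subsetD)
  ultimately show ?case
    using join.IH by (auto simp: chain_in_def successively_append_iff)
qed

lemma traverses_mono:
  assumes "traverses E f a b zs" "\<And>S. S \<in> E \<Longrightarrow> \<exists>T\<in>E'. S \<subseteq> T"
  shows "traverses E' f a b zs"
  using assms(1)
proof (induction rule: traverses.induct)
  case (piece a b S)
  then show ?case using assms(2) by (meson order_trans traverses.piece)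
qed (rule traverses.join)

text \<open>Rescaling and reversing the parameter. The values of \<open>g\<close> matter only on the new interval, so the case
  \<open>m = 1\<close>, \<open>p = 0\<close> replaces a function by one that agrees with it there.\<close>

lemma traverses_affine_substitution:
  assumes "traverses E f a b zs"
    and "m \<noteq> 0" "a = p + m * a'" "b = p + m * b'"
    and "\<And>t. p + m * t \<in> {a..b} \<Longrightarrow> g t = f (p + m * t)"
  shows "if m > 0 then traverses E g a' b' zs else traverses E g b' a' (rev zs)"
  using assms
proof (induction arbitrary: a' b' rule: traverses.induct)
  case (piece a b S)
  note ab = \<open>a = p + m * a'\<close> \<open>b = p + m * b'\<close>
  let ?I = "if m > 0 then {a'..b'} else {b'..a'}"
  obtain q v where qv: "\<And>t. t \<in> {a..b} \<Longrightarrow> f t = q + t *\<^sub>R v"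
    using piece.hyps by (auto simp: affine_on_interval_def)
  have I: "p + m * t \<in> {a..b}" if "t \<in> ?I" for t
    using that piece.prems(1) unfolding ab by (auto split: if_splits)
  have g: "g t = f (p + m * t)" if "t \<in> ?I" for t
    by (rule piece.prems(4)[OF I[OF that]])
  have "\<forall>t\<in>?I. g t = (q + p *\<^sub>R v) + t *\<^sub>R (m *\<^sub>R v)"
    using qv I g by (simp add: algebra_simps)
  then have "if m > 0 then affine_on_interval a' b' g else affine_on_interval b' a' g"
    unfolding affine_on_interval_def by (cases "m > 0"; simp only: if_True if_False; blast)
  moreover have "g ` ?I \<subseteq> S"
    using piece.hyps I g by fastforce
  moreover have "g a' = f a" "g b' = f b"
    using piece.prems(4)[of a'] piece.prems(4)[of b'] piece.hyps(1) ab by auto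
  moreover have "if m > 0 then a' \<le> b' else b' \<le> a'"
    using piece.hyps(1) piece.prems(1) unfolding ab by (auto simp: mult_le_cancel_left)
  ultimately show ?case
    using traverses.piece[of a' b' g S E] traverses.piece[of b' a' g S E] \<open>S \<in> E\<close>
    by (cases "m > 0") simp_all
next
  case (join a c xs b ys)
  define c' where "c' = (c - p) / m"
  have c: "c = p + m * c'"
    using join.prems by (simp add: c'_def)
  have "a \<le> c" "c \<le> b"
    using join.hyps traverses_le by blast+
  then have "if m > 0 then traverses E g a' c' xs else traverses E g c' a' (rev xs)"
    and "if m > 0 then traverses E g c' b' ys else traverses E g b' c' (rev ys)"
    using join.prems c by (intro join.IH; simp)+
  then show ?case
    by (auto intro: traverses.join)
qed

lemma traverses_split:
  fixes f :: "real \<Rightarrow> 'a::euclidean_space"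
  assumes "traverses C f a b zs" "c \<in> {a..b}"
  shows "\<exists>xs ys. traverses C f a c xs \<and> traverses C f c b ys \<and> list_eqv C zs (xs @ ys)"
  using assms
proof (induction arbitrary: c rule: traverses.induct)
  case (piece a b S)
  have "affine_on_interval a c f" "affine_on_interval c b f" "f ` {a..c} \<subseteq> S" "f ` {c..b} \<subseteq> S"
    using piece by (auto intro!: affine_on_interval_subset[OF piece.hyps(2)])
  then have "traverses C f a c [f a, f c]" "traverses C f c b [f c, f b]"
    using piece by (auto intro!: traverses.piece[of _ _ _ S])
  moreover have "collinear {f a, f c, f b}"
    using piece by (intro collinear_subset[OF affine_on_interval_collinear[OF piece.hyps(2)]]) auto
  then have "list_eqv C ([f a, f c] @ [f c, f b]) [f a, f b]"
    using piece by (intro list_eqv_merge[of S]) auto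
  ultimately show ?case
    using list_eqv_sym by blast
next
  case (join a d xs b ys)
  show ?case
  proof (cases "c \<le> d")
    case True
    with join.prems have "c \<in> {a..d}" by simp
    then obtain xs1 xs2 where *: "traverses C f a c xs1" "traverses C f c d xs2"
        "list_eqv C xs (xs1 @ xs2)"
      using join.IH(1) by blast
    then have "traverses C f c b (xs2 @ ys)" "list_eqv C (xs @ ys) (xs1 @ (xs2 @ ys))"
      using traverses.join join.hyps list_eqv_append[OF *(3) list_eqv_refl] by auto
    with * show ?thesis by blast
  next
    case False
    with join.prems have "c \<in> {d..b}" by simp
    then obtain ys1 ys2 where *: "traverses C f d c ys1" "traverses C f c b ys2"
        "list_eqv C ys (ys1 @ ys2)"
      using join.IH(2) by blast
    then have "traverses C f a c (xs @ ys1)" "list_eqv C (xs @ ys) ((xs @ ys1) @ ys2)"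
      using traverses.join join.hyps list_eqv_append[OF list_eqv_refl *(3)] by auto
    with * show ?thesis by blast
  qed
qed

text \<open>On a straight path inside one cell every intermediate vertex is aligned with its neighbours.\<close>

lemma traverses_straight:
  fixes f :: "real \<Rightarrow> 'a::euclidean_space"
  assumes "traverses C f a b zs" "collinear (f ` {a..b})" "S \<in> C" "f ` {a..b} \<subseteq> S"
  shows "list_eqv C zs [f a, f b]"
  using assms
proof (induction rule: traverses.induct)
  case (piece a b T)
  then show ?case by simp
next
  case (join a c xs b ys)
  have le: "a \<le> c" "c \<le> b"
    using join.hyps traverses_le by blast+
  have "list_eqv C xs [f a, f c]" "list_eqv C ys [f c, f b]"
    using join.prems le
    by (intro join.IH; auto intro: collinear_subset)+
  then have "list_eqv C (xs @ ys) ([f a, f c] @ [f c, f b])"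
    by (rule list_eqv_append)
  also have "list_eqv C \<dots> [f a, f b]"
    using join.prems le by (intro list_eqv_merge[of S]) (auto intro: collinear_subset)
  finally show ?case .
qed

text \<open>Any two subdivisions have a common refinement, and refining a piece only inserts points of a
  segment inside one member of \<open>C\<close>.\<close>

lemma traverses_unique:
  fixes f :: "real \<Rightarrow> 'a::euclidean_space"
  assumes "traverses C f a b zs" "traverses C f a b ws"
  shows "list_eqv C zs ws"
  using assms
proof (induction arbitrary: ws rule: traverses.induct)
  case (piece a b S)
  then show ?case
    by (intro list_eqv_sym[OF traverses_straight] affine_on_interval_collinear)
next
  case (join a c xs b ys)
  have "c \<in> {a..b}"
    using join.hyps traverses_le by (metis atLeastAtMost_iff)
  then obtain xs' ys' where *: "traverses C f a c xs'" "traverses C f c b ys'" "list_eqv C ws (xs' @ ys')"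
    using traverses_split[OF join.prems] by blast
  have "list_eqv C (xs @ ys) (xs' @ ys')"
    using * join.IH by (intro list_eqv_append)
  also have "list_eqv C \<dots> ws"
    using * list_eqv_sym by blast
  finally show ?case .
qed

text \<open>An affine path meets each closed convex set in a closed parameter interval. Between two
  consecutive end points of these finitely many intervals it stays in one of the sets.\<close>

lemma affine_path_traverses_cover:
  fixes f :: "real \<Rightarrow> 'a::euclidean_space"
  assumes "a \<le> b" "affine_on_interval a b f" "finite E"
    and E: "\<And>S. S \<in> E \<Longrightarrow> closed S \<and> convex S" and "f ` {a..b} \<subseteq> \<Union>E"
  shows "\<exists>zs. traverses E f a b zs"
proof -
  obtain p v where pv: "\<And>t. t \<in> {a..b} \<Longrightarrow> f t = p + t *\<^sub>R v"
    using assms by (auto simp: affine_on_interval_def)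
  define I where "I S = {t \<in> {a..b}. f t \<in> S}" for S
  have I: "compact (I S) \<and> convex (I S)" if "S \<in> E" for S
  proof
    have "closed ({a..b} \<inter> f -` S)"
      using E that affine_on_interval_continuous[OF assms(2)]
      by (intro continuous_closed_preimage) auto
    moreover have "I S = {a..b} \<inter> f -` S"
      by (auto simp: I_def)
    ultimately show "compact (I S)"
      by (metis Int_lower1 bounded_closed_interval bounded_subset compact_eq_bounded_closed)
    have eq: "I S = {a..b} \<inter> (\<lambda>t. p + t *\<^sub>R v) -` S"
      using pv by (auto simp: I_def)
    have "convex {t. p + t *\<^sub>R v \<in> S}"
    proof (rule convexI)
      fix s t x y :: real
      assume st: "s \<in> {t. p + t *\<^sub>R v \<in> S}" "t \<in> {t. p + t *\<^sub>R v \<in> S}" and xy: "0 \<le> x" "0 \<le> y" "x + y = 1"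
      have "x *\<^sub>R (p + s *\<^sub>R v) + y *\<^sub>R (p + t *\<^sub>R v) \<in> S"
        using E[OF that] st xy by (intro convexD) auto
      also have "x *\<^sub>R (p + s *\<^sub>R v) + y *\<^sub>R (p + t *\<^sub>R v) = (x + y) *\<^sub>R p + (x * s + y * t) *\<^sub>R v"
        by (simp add: algebra_simps)
      finally show "x *\<^sub>R s + y *\<^sub>R t \<in> {t. p + t *\<^sub>R v \<in> S}"
        using xy by simp
    qed
    then show "convex (I S)"
      unfolding eq by (intro convex_Int) (auto simp: vimage_def)
  qed
  \<comment> \<open>The end points of the parameter intervals of all members of \<open>E\<close>; the induction is on the number of
    them inside the current interval.\<close>
  define B where "B = (\<Union>S\<in>E. {Inf (I S), Sup (I S)})"
  have "finite B"
    using assms by (auto simp: B_def)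
  have "\<exists>zs. traverses E f c d zs" if "a \<le> c" "c \<le> d" "d \<le> b" "card (B \<inter> {c<..<d}) = n" for c d n
    using that
  proof (induction n arbitrary: c d rule: less_induct)
    case (less n)
    show ?case
    proof (cases "B \<inter> {c<..<d} = {}")
      case True
      \<comment> \<open>The parameter interval of a set that contains the midpoint ends nowhere inside \<open>(c, d)\<close>.\<close>
      have "(c + d) / 2 \<in> {a..b}"
        using less.prems by auto
      then obtain S where S: "S \<in> E" "f ((c + d) / 2) \<in> S"
        using assms(5) by blast
      then have m: "(c + d) / 2 \<in> I S"
        using less.prems by (auto simp: I_def)
      have "Inf (I S) \<in> B" "Sup (I S) \<in> B"
        using S by (auto simp: B_def)
      moreover have "bdd_below (I S)" "bdd_above (I S)" "closed (I S)" "I S \<noteq> {}"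
        using m I[OF S(1)] by (auto intro: compact_imp_closed bounded_imp_bdd_below
            bounded_imp_bdd_above compact_imp_bounded)
      then have "Inf (I S) \<in> I S" "Sup (I S) \<in> I S" "Inf (I S) \<le> (c + d) / 2" "(c + d) / 2 \<le> Sup (I S)"
        using m by (auto intro!: closed_contains_Inf closed_contains_Sup intro: cInf_lower cSup_upper
            simp del: le_divide_eq_numeral1 divide_le_eq_numeral1)
      ultimately have "Inf (I S) \<le> c" "d \<le> Sup (I S)"
        using True less.prems by (auto simp: disjoint_iff not_less)
      moreover have "is_interval (I S)"
        using I[OF S(1)] by (simp add: is_interval_convex_1)
      ultimately have "{c..d} \<subseteq> I S"
        using \<open>Inf (I S) \<in> I S\<close> \<open>Sup (I S) \<in> I S\<close> unfolding is_interval_1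
        by (meson atLeastAtMost_iff order_trans subsetI)
      then have "f ` {c..d} \<subseteq> S"
        by (auto simp: I_def)
      then show ?thesis
        using less.prems S traverses.piece affine_on_interval_subset[OF assms(2)]
        by (metis atLeastatMost_subset_iff)
    next
      case False
      then obtain e where e: "e \<in> B" "c < e" "e < d"
        by auto
      have "B \<inter> {c<..<e} \<subset> B \<inter> {c<..<d}" "B \<inter> {e<..<d} \<subset> B \<inter> {c<..<d}"
        using e by auto
      then have "card (B \<inter> {c<..<e}) < n" "card (B \<inter> {e<..<d}) < n"
        using less.prems \<open>finite B\<close> by (metis finite_Int psubset_card_mono)+
      then have "\<exists>zs. traverses E f c e zs" "\<exists>zs. traverses E f e d zs"
        using e less.prems less.IH[OF _ _ _ _ refl] by auto
      then show ?thesis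
        using traverses.join by blast
    qed
  qed
  then show ?thesis
    using \<open>a \<le> b\<close> by blast
qed

lemma traverses_cover:
  fixes f :: "real \<Rightarrow> 'a::euclidean_space"
  assumes "traverses E' f a b zs" "finite E"
    and "\<And>S. S \<in> E \<Longrightarrow> closed S \<and> convex S" and "f ` {a..b} \<subseteq> \<Union>E"
  shows "\<exists>zs. traverses E f a b zs"
  using assms
proof (induction rule: traverses.induct)
  case (piece a b S)
  then show ?case by (intro affine_path_traverses_cover)
next
  case (join a c xs b ys)
  have "a \<le> c" "c \<le> b"
    using join.hyps traverses_le by blast+
  then have "\<exists>zs. traverses E f a c zs" "\<exists>zs. traverses E f c b zs"
    using join.prems by (intro join.IH; auto)+
  then show ?case
    using traverses.join by blast
qed

text \<open>An affine substitution is constant or monotone, so it crosses each joint of \<open>f\<close> at one parameter at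
  most, where the interval is cut.\<close>

lemma traverses_compose_affine:
  fixes f :: "real \<Rightarrow> 'a::real_vector" and \<phi> :: "real \<Rightarrow> real"
  assumes "traverses E f c d zs"
    and "a \<le> b" "affine_on_interval a b \<phi>" "\<phi> ` {a..b} \<subseteq> {c..d}"
  shows "\<exists>ws. traverses E (f \<circ> \<phi>) a b ws"
  using assms
proof (induction arbitrary: a b rule: traverses.induct)
  case (piece c d S)
  obtain p v where pv: "\<And>t. t \<in> {a..b} \<Longrightarrow> \<phi> t = p + t *\<^sub>R v"
    using piece by (auto simp: affine_on_interval_def)
  obtain q w where qw: "\<And>t. t \<in> {c..d} \<Longrightarrow> f t = q + t *\<^sub>R w"
    using piece by (auto simp: affine_on_interval_def)
  have "(f \<circ> \<phi>) t = (q + p *\<^sub>R w) + t *\<^sub>R (v *\<^sub>R w)" if "t \<in> {a..b}" for t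
  proof -
    have "\<phi> t \<in> {c..d}" using piece that by blast
    then show ?thesis
      using that pv[OF that] by (simp add: qw algebra_simps)
  qed
  then have "affine_on_interval a b (f \<circ> \<phi>)"
    unfolding affine_on_interval_def by blast
  moreover have "(f \<circ> \<phi>) ` {a..b} \<subseteq> S"
    using piece by (auto simp: image_subset_iff)
  ultimately have "traverses E (f \<circ> \<phi>) a b [(f \<circ> \<phi>) a, (f \<circ> \<phi>) b]"
    by (intro traverses.piece[OF \<open>a \<le> b\<close> _ \<open>S \<in> E\<close>])
  then show ?case ..
next
  case (join c m xs d ys)
  obtain p v where pv: "\<And>t. t \<in> {a..b} \<Longrightarrow> \<phi> t = p + t * v"
    using join by (auto simp: affine_on_interval_def)
  have sub: "affine_on_interval a' b' \<phi>" if "{a'..b'} \<subseteq> {a..b}" for a' b'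
    using affine_on_interval_subset join.prems that by blast
  show ?case
  proof (cases "\<phi> ` {a..b} \<subseteq> {c..m} \<or> \<phi> ` {a..b} \<subseteq> {m..d}")
    case True
    then show ?thesis using join by blast
  next
    case False
    then obtain s t where st: "s \<in> {a..b}" "t \<in> {a..b}" "\<phi> s > m" "\<phi> t < m"
      using join.prems(3) by (auto simp: image_subset_iff not_le)
    have "connected (\<phi> ` {a..b})"
      using affine_on_interval_continuous[OF join.prems(2)] by (rule connected_continuous_image) simp
    then have "is_interval (\<phi> ` {a..b})"
      by (simp add: is_interval_connected_1)
    then have "m \<in> \<phi> ` {a..b}"
      using st unfolding is_interval_1 by (meson imageI less_imp_le)
    then obtain e where e: "e \<in> {a..b}" "\<phi> e = m"
      by blast
    have range: "\<phi> r \<in> {c..d}" if "r \<in> {a..b}" for r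
      using join.prems that by blast
    have "v \<noteq> 0"
      using st pv by auto
    then consider "v > 0" | "v < 0" by linarith
    then have "(\<exists>ws. traverses E (f \<circ> \<phi>) a e ws) \<and> (\<exists>ws. traverses E (f \<circ> \<phi>) e b ws)"
    proof cases
      case 1
      then have "\<phi> r \<le> m" if "r \<in> {a..e}" for r
        using that e pv[of r] pv[of e] by auto
      moreover have "m \<le> \<phi> r" if "r \<in> {e..b}" for r
        using that e pv[of r] pv[of e] 1 by auto
      ultimately have "\<phi> ` {a..e} \<subseteq> {c..m}" "\<phi> ` {e..b} \<subseteq> {m..d}"
        using range e by fastforce+
      then show "(\<exists>ws. traverses E (f \<circ> \<phi>) a e ws) \<and> (\<exists>ws. traverses E (f \<circ> \<phi>) e b ws)"
        using e by (intro conjI join.IH(1)[OF _ sub] join.IH(2)[OF _ sub]) auto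
    next
      case 2
      then have "m \<le> \<phi> r" if "r \<in> {a..e}" for r
        using that e pv[of r] pv[of e] by auto
      moreover have "\<phi> r \<le> m" if "r \<in> {e..b}" for r
        using that e pv[of r] pv[of e] 2 by auto
      ultimately have "\<phi> ` {a..e} \<subseteq> {m..d}" "\<phi> ` {e..b} \<subseteq> {c..m}"
        using range e by fastforce+
      then show "(\<exists>ws. traverses E (f \<circ> \<phi>) a e ws) \<and> (\<exists>ws. traverses E (f \<circ> \<phi>) e b ws)"
        using e by (intro conjI join.IH(2)[OF _ sub] join.IH(1)[OF _ sub]) auto
    qed
    then show ?thesis
      using traverses.join by blast
  qed
qed

lemma traverses_compose:
  fixes f :: "real \<Rightarrow> 'a::real_vector" and \<phi> :: "real \<Rightarrow> real"
  assumes "traverses E' \<phi> a b us" "traverses E f c d zs" "\<phi> ` {a..b} \<subseteq> {c..d}"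
  shows "\<exists>ws. traverses E (f \<circ> \<phi>) a b ws"
  using assms
proof (induction rule: traverses.induct)
  case (piece a b S)
  show ?case
    by (rule traverses_compose_affine[OF piece.prems(1) piece.hyps(1,2) piece.prems(2)])
next
  case (join a m xs b ys)
  have "a \<le> m" "m \<le> b"
    using join.hyps traverses_le by blast+
  then have "\<phi> ` {a..m} \<subseteq> {c..d}" "\<phi> ` {m..b} \<subseteq> {c..d}"
    using join.prems by auto
  then have "\<exists>ws. traverses E (f \<circ> \<phi>) a m ws" "\<exists>ws. traverses E (f \<circ> \<phi>) m b ws"
    using join.prems join.IH by blast+
  then show ?case
    using traverses.join by blast
qed

lemma traverses_subdivision:
  assumes "traverses E f a b zs"
  shows "\<exists>k t. t 0 = a \<and> t k = b \<and> (\<forall>i<k. t i < t (Suc i) \<and>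
     affine_on_interval (t i) (t (Suc i)) f \<and> (\<exists>S\<in>E. f ` {t i..t (Suc i)} \<subseteq> S))"
  using assms
proof (induction rule: traverses.induct)
  case (piece a b S)
  show ?case
  proof (cases "a = b")
    case True
    then show ?thesis by (intro exI[of _ 0] exI[of _ "\<lambda>_. a"]) simp
  next
    case False
    with piece show ?thesis
      by (intro exI[of _ 1] exI[of _ "\<lambda>i. if i = 0 then a else b"]) auto
  qed
next
  case (join a c xs b ys)
  then obtain k t l s where k: "t 0 = a" "t k = c" and t: "\<And>i. i < k \<Longrightarrow> t i < t (Suc i) \<and>
        affine_on_interval (t i) (t (Suc i)) f \<and> (\<exists>S\<in>E. f ` {t i..t (Suc i)} \<subseteq> S)"
      and l: "s 0 = c" "s l = b" and s: "\<And>i. i < l \<Longrightarrow> s i < s (Suc i) \<and>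
        affine_on_interval (s i) (s (Suc i)) f \<and> (\<exists>S\<in>E. f ` {s i..s (Suc i)} \<subseteq> S)"
    by metis
  define r where "r i = (if i \<le> k then t i else s (i - k))" for i
  have "r i < r (Suc i) \<and> affine_on_interval (r i) (r (Suc i)) f \<and>
      (\<exists>S\<in>E. f ` {r i..r (Suc i)} \<subseteq> S)" if "i < k + l" for i
  proof (cases "i < k")
    case True
    then show ?thesis using t by (simp add: r_def)
  next
    case False
    then have "r i = s (i - k)" "r (Suc i) = s (Suc (i - k))"
      using k l by (auto simp: r_def Suc_diff_le)
    then show ?thesis using s[of "i - k"] that False by simp
  qed
  moreover have "r 0 = a" "r (k + l) = b"
    using k l by (auto simp: r_def)
  ultimately show ?case by blast
qed

lemma subdivision_traverses:
  fixes t :: "nat \<Rightarrow> real"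
  assumes "0 < k"
    and "\<And>i. i < k \<Longrightarrow> t i \<le> t (Suc i) \<and> affine_on_interval (t i) (t (Suc i)) f \<and>
      (\<exists>S\<in>E. f ` {t i..t (Suc i)} \<subseteq> S)"
  shows "\<exists>zs. traverses E f (t 0) (t k) zs \<and> list_eqv E zs (map (f \<circ> t) [0..<Suc k])"
  using assms
proof (induction k rule: nat_induct_non_zero)
  case 1
  then have "traverses E f (t 0) (t 1) [f (t 0), f (t 1)]"
    using traverses.piece[of "t 0" "t 1" f _ E] by auto
  then show ?case by (force simp: upt_rec)
next
  case (Suc k)
  then obtain zs where zs: "traverses E f (t 0) (t k) zs" "list_eqv E zs (map (f \<circ> t) [0..<Suc k])"
    using Suc.IH less_Suc_eq by blast
  have "traverses E f (t k) (t (Suc k)) [f (t k), f (t (Suc k))]"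
    using Suc.prems[of k] traverses.piece[of "t k" "t (Suc k)" f _ E] by auto
  then have "traverses E f (t 0) (t (Suc k)) (zs @ [f (t k), f (t (Suc k))])"
    using zs traverses.join by blast
  moreover have "list_eqv E (zs @ [f (t k), f (t (Suc k))])
      (map (f \<circ> t) [0..<Suc k] @ [f (t k), f (t (Suc k))])"
    using zs by (intro list_eqv_append) auto
  moreover have "list_eqv E (map (f \<circ> t) [0..<Suc k] @ [f (t k), f (t (Suc k))])
      (map (f \<circ> t) [0..<Suc (Suc k)])"
    using list_eqv_context[OF list_eqv_repeated, of E "map (f \<circ> t) [0..<k]" "f (t k)" "[f (t (Suc k))]"]
    by simp
  ultimately show ?case
    by (blast intro: list_eqv_trans)
qed

text \<open>A PL path in a finite union of closed convex cells can be cut into finitely many affine pieces that stay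
  in one cell each, and limits of such pieces are again of this kind.\<close>

locale convex_cover =
  fixes C :: "'a::euclidean_space set set" and x0 :: 'a
  assumes finite_cells: "finite C"
    and closed_cell: "S \<in> C \<Longrightarrow> closed S"
    and convex_cell: "S \<in> C \<Longrightarrow> convex S"
    and base_point: "x0 \<in> \<Union>C"
begin

lemma pl_loops_iff:
  "\<gamma> \<in> pl_loops C x0 \<longleftrightarrow>
     \<gamma> \<in> extensional {0..1} \<and> (\<exists>zs. traverses C \<gamma> 0 1 zs) \<and> \<gamma> 0 = x0 \<and> \<gamma> 1 = x0"
proof
  assume *: "\<gamma> \<in> pl_loops C x0"
  then obtain k t where kt: "t 0 = 0" "t k = 1"
      "\<And>i. i < k \<Longrightarrow> t i < t (Suc i) \<and> affine_on_interval (t i) (t (Suc i)) \<gamma>"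
    by (auto simp: pl_loops_def piecewise_linear_path_def)
  then have "0 < k"
    by (cases k) auto
  then obtain zs where "traverses {UNIV} \<gamma> (t 0) (t k) zs"
    using subdivision_traverses[of k t \<gamma> "{UNIV}"] kt(3) by (auto simp: less_imp_le)
  moreover have "\<gamma> ` {0..1} \<subseteq> \<Union>C"
    using * by (auto simp: pl_loops_def)
  ultimately have "\<exists>zs. traverses C \<gamma> 0 1 zs"
    using traverses_cover[of "{UNIV}" \<gamma> 0 1 zs C] kt finite_cells closed_cell convex_cell by auto
  with * show "\<gamma> \<in> extensional {0..1} \<and> (\<exists>zs. traverses C \<gamma> 0 1 zs) \<and> \<gamma> 0 = x0 \<and> \<gamma> 1 = x0"
    by (auto simp: pl_loops_def PiE_def pathstart_def pathfinish_def)
next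
  assume *: "\<gamma> \<in> extensional {0..1} \<and> (\<exists>zs. traverses C \<gamma> 0 1 zs) \<and> \<gamma> 0 = x0 \<and> \<gamma> 1 = x0"
  then obtain zs where zs: "traverses C \<gamma> 0 1 zs"
    by blast
  obtain k t where "t 0 = 0 \<and> t k = 1 \<and> (\<forall>i<k. t i < t (Suc i) \<and>
      affine_on_interval (t i) (t (Suc i)) \<gamma> \<and> (\<exists>S\<in>C. \<gamma> ` {t i..t (Suc i)} \<subseteq> S))"
    using traverses_subdivision[OF zs] by blast
  then have "piecewise_linear_path \<gamma>"
    unfolding piecewise_linear_path_def path_def using traverses_continuous[OF zs] by blast
  then show "\<gamma> \<in> pl_loops C x0"
    using * traverses_image[OF zs] by (auto simp: pl_loops_def PiE_def pathstart_def pathfinish_def)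
qed

lemma pl_loops_traverses:
  assumes "\<gamma> \<in> pl_loops C x0"
  obtains zs where "traverses C \<gamma> 0 1 zs"
  using assms that unfolding pl_loops_iff by blast

section \<open>Thin loops have trivial vertex lists\<close>

text \<open>The pieces of the image of a PL path; degenerate segments are included.\<close>

definition is_segment :: "'a set \<Rightarrow> bool" where
  "is_segment E \<longleftrightarrow> closed E \<and> convex E \<and> collinear E \<and> (\<exists>S\<in>C. E \<subseteq> S)"

lemma traverses_image_segments:
  assumes "traverses C f a b zs"
  shows "\<exists>G. finite G \<and> (\<forall>E\<in>G. is_segment E) \<and> f ` {a..b} = \<Union>G"
  using assms
proof (induction rule: traverses.induct)
  case (piece a b S)
  then have "is_segment (f ` {a..b})"
    using affine_on_interval_image[of a b f] affine_on_interval_collinear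
    by (auto simp: is_segment_def compact_imp_closed)
  then show ?case
    by (intro exI[of _ "{f ` {a..b}}"]) auto
next
  case (join a c xs b ys)
  then obtain G H where "finite G" "\<forall>E\<in>G. is_segment E" "f ` {a..c} = \<Union>G"
    "finite H" "\<forall>E\<in>H. is_segment E" "f ` {c..b} = \<Union>H"
    by metis
  moreover have "{a..b} = {a..c} \<union> {c..b}"
    using join.hyps traverses_le by (metis ivl_disj_un_two_touch(4))
  ultimately show ?case
    by (intro exI[of _ "G \<union> H"]) (auto simp: image_Un)
qed

lemma segments_aligned:
  assumes "is_segment E" "a \<in> E" "b \<in> E" "c \<in> E"
  shows "list_eqv C [a, b, c] [a, c]"
proof -
  obtain S where "S \<in> C" "E \<subseteq> S" "collinear E"
    using assms by (auto simp: is_segment_def)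
  then show ?thesis
    using assms by (intro list_eqv_aligned[of S]) (auto intro: collinear_subset[of E])
qed

text \<open>Every piece runs along a segment through \<open>p\<close>, hence is equivalent to its detour through \<open>p\<close>, and
  between two visits of \<open>p\<close> nothing but an excursion \<open>(p, f c, p)\<close> remains.\<close>

lemma traverses_star:
  assumes "traverses E f a b ws" "\<And>T. T \<in> E \<Longrightarrow> is_segment T \<and> p \<in> T"
  shows "list_eqv C ws [f a, p, f b]"
  using assms
proof (induction rule: traverses.induct)
  case (piece a b T)
  then have "f a \<in> T" "f b \<in> T" by auto
  with piece show ?case
    by (intro list_eqv_sym[OF segments_aligned[of T]]) auto
next
  case (join a c xs b ys)
  have "f c \<in> \<Union>E"
    using join.hyps traverses_image traverses_le by (meson atLeastAtMost_iff imageI order_refl subsetD)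
  then obtain T where T: "T \<in> E" "f c \<in> T"
    by blast
  then obtain S where S: "S \<in> C" "f c \<in> S" "p \<in> S"
    using join.prems[OF T(1)] unfolding is_segment_def by blast
  have "list_eqv C (xs @ ys) ([f a, p, f c] @ [f c, p, f b])"
    using join by (intro list_eqv_append) auto
  also have "list_eqv C \<dots> ([f a] @ [p, f c, p] @ [f b])"
    using list_eqv_context[OF list_eqv_repeated, of C "[f a, p]" "f c" "[p, f b]"] by simp
  also have "list_eqv C \<dots> ([f a] @ [p] @ [f b])"
    using S by (intro list_eqv_context list_eqv_backtrack)
  finally show ?case by simp
qed

text \<open>The segments that miss \<open>p\<close> have a closed union, which stays away from \<open>p\<close>.\<close>

lemma segments_star_radius:
  assumes "finite G" "\<forall>E\<in>G. is_segment E"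
  shows "\<exists>r>0. \<forall>x E. E \<in> G \<longrightarrow> x \<in> E \<longrightarrow> dist p x < r \<longrightarrow> p \<in> E"
proof -
  have "closed (\<Union>{E \<in> G. p \<notin> E})"
    using assms by (intro closed_Union) (auto simp: is_segment_def)
  then have "open (- \<Union>{E \<in> G. p \<notin> E})"
    by blast
  moreover have "p \<in> - \<Union>{E \<in> G. p \<notin> E}"
    by blast
  ultimately obtain r where "r > 0" "ball p r \<subseteq> - \<Union>{E \<in> G. p \<notin> E}"
    using open_contains_ball by meson
  then show ?thesis
    by (intro exI[of _ r]) (auto simp: subset_iff)
qed

text \<open>Cut the parameter interval finely enough that each piece of \<open>f\<close>, and of every path near \<open>f\<close>,
  lies in the star of one point \<open>p\<^sub>j\<close> of the graph. The two vertex lists then become the two sides of a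
  ladder whose rungs and diagonals run along single segments of the graph.\<close>

lemma nearby_paths_eqv:
  assumes G: "finite G" "\<forall>E\<in>G. is_segment E"
    and f: "traverses C f 0 1 zf" "f ` {0..1} \<subseteq> \<Union>G"
  shows "\<exists>e>0. \<forall>g zg. traverses C g 0 1 zg \<longrightarrow> g ` {0..1} \<subseteq> \<Union>G \<longrightarrow> g 0 = f 0 \<longrightarrow> g 1 = f 1 \<longrightarrow>
    (\<forall>t\<in>{0..1}. dist (f t) (g t) < e) \<longrightarrow> list_eqv C zg zf"
proof -
  obtain r where r: "\<And>p. r p > 0" "\<And>p x E. E \<in> G \<Longrightarrow> x \<in> E \<Longrightarrow> dist p x < r p \<Longrightarrow> p \<in> E"
    using segments_star_radius[OF G] by metis
  have cont: "continuous_on {0..1} f"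
    using traverses_continuous[OF f(1)] .
  then have "compact (f ` {0..1})"
    by (intro compact_continuous_image) auto
  then obtain e where e: "e > 0" "\<And>x. x \<in> f ` {0..1} \<Longrightarrow> \<exists>B \<in> range (\<lambda>p. ball p (r p)). ball x e \<subseteq> B"
  proof (rule Heine_Borel_lemma[of "f ` {0..1}" "range (\<lambda>p. ball p (r p))"])
    show "f ` {0..1} \<subseteq> \<Union> (range (\<lambda>p. ball p (r p)))"
      using r(1) by (auto intro: centre_in_ball[THEN iffD2])
  qed auto
  have "uniformly_continuous_on {0..1} f"
    using cont by (intro compact_uniformly_continuous) auto
  then obtain d where d: "d > 0"
      "\<And>s t. s \<in> {0..1} \<Longrightarrow> t \<in> {0..1} \<Longrightarrow> dist t s < d \<Longrightarrow> dist (f t) (f s) < e / 2"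
    unfolding uniformly_continuous_on_def using e(1) by (metis half_gt_zero)
  obtain N where N: "N > 0" "1 / real N < d"
    using d(1) by (metis nat_approx_posE zero_less_Suc)
  define u where "u j = real j / real N" for j
  have u: "u 0 = 0" "u N = 1" and u01: "\<And>j. j \<le> N \<Longrightarrow> u j \<in> {0..1}"
    and us: "\<And>j. u j \<le> u (Suc j)" "\<And>j. u (Suc j) - u j = 1 / real N"
    using N(1) by (auto simp: u_def divide_right_mono field_simps)
  \<comment> \<open>\<open>e\<close> is a Lebesgue number of the cover of the image by stars; on the \<open>j\<close>-th interval \<open>f\<close>, and each
    path within \<open>e / 2\<close> of it, stays in the star of \<open>p j\<close>.\<close>
  have "\<exists>q. ball (f (u j)) e \<subseteq> ball q (r q)" if "j \<le> N" for j
    using e(2)[OF imageI[OF u01[OF that]]] by blast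
  then obtain p where p: "\<And>j. j \<le> N \<Longrightarrow> ball (f (u j)) e \<subseteq> ball (p j) (r (p j))"
    by metis
  \<comment> \<open>The second bound puts \<open>g (u j)\<close> into the star of \<open>f (u j)\<close>, so that the rungs of the ladder are segments.\<close>
  define \<epsilon> where "\<epsilon> = Min (insert (e / 2) ((\<lambda>j. r (f (u j))) ` {..N}))"
  have fin: "finite (insert (e / 2) ((\<lambda>j. r (f (u j))) ` {..N}))"
    by simp
  have "\<epsilon> \<in> insert (e / 2) ((\<lambda>j. r (f (u j))) ` {..N})"
    unfolding \<epsilon>_def by (rule Min_in[OF fin]) simp
  moreover have "\<epsilon> \<le> e / 2" "\<And>j. j \<le> N \<Longrightarrow> \<epsilon> \<le> r (f (u j))"
    unfolding \<epsilon>_def by (rule Min_le[OF fin]; simp)+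
  ultimately have \<epsilon>: "\<epsilon> > 0" "\<epsilon> \<le> e / 2" "\<And>j. j \<le> N \<Longrightarrow> \<epsilon> \<le> r (f (u j))"
    using e(1) r(1) by auto
  have star: "list_eqv C ws [g (u j), p j, g (u (Suc j))]"
    if g: "traverses C g (u j) (u (Suc j)) ws" "g ` {0..1} \<subseteq> \<Union>G"
      "\<forall>t\<in>{0..1}. dist (f t) (g t) < e / 2" and j: "j < N" for g j ws
  proof -
    let ?E = "{E \<in> G. p j \<in> E}"
    have "g t \<in> \<Union>?E" if t: "t \<in> {u j..u (Suc j)}" for t
    proof -
      have t01: "t \<in> {0..1}" "u j \<in> {0..1}"
        using t u01[of j] u01[of "Suc j"] j by auto
      have "dist t (u j) < d"
        using t us(2)[of j] N by (auto simp: dist_real_def)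
      then have "dist (f t) (f (u j)) < e / 2"
        using d(2) t01 by blast
      then have "dist (f (u j)) (g t) < e"
        using g(3) t01 by (metis dist_commute dist_triangle_half_r)
      then have "dist (p j) (g t) < r (p j)"
        using p[of j] j by auto
      moreover obtain E where "E \<in> G" "g t \<in> E"
        using g(2) t01 by blast
      ultimately show ?thesis
        using r(2) by blast
    qed
    then obtain ws' where ws': "traverses ?E g (u j) (u (Suc j)) ws'"
      using traverses_cover[OF g(1), of ?E] G by (fastforce simp: is_segment_def)
    then have "traverses C g (u j) (u (Suc j)) ws'"
      using G by (elim traverses_mono) (auto simp: is_segment_def)
    then have "list_eqv C ws ws'"
      using traverses_unique g(1) by blast
    also have "list_eqv C ws' [g (u j), p j, g (u (Suc j))]"
      using ws' G by (elim traverses_star) auto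
    finally show ?thesis .
  qed
  have "list_eqv C zg zf"
    if g: "traverses C g 0 1 zg" "g ` {0..1} \<subseteq> \<Union>G" "g 0 = f 0" "g 1 = f 1"
      and close: "\<forall>t\<in>{0..1}. dist (f t) (g t) < \<epsilon>" for g zg
  proof -
    have close2: "\<forall>t\<in>{0..1}. dist (f t) (g t) < e / 2" and ff: "\<forall>t\<in>{0..1}. dist (f t) (f t) < e / 2"
      using close \<epsilon>(2) e(1) by fastforce+
    \<comment> \<open>A segment through \<open>g (u i)\<close> also passes through \<open>f (u i)\<close> and \<open>p j\<close>.\<close>
    have rung: "list_eqv C [f (u i), g (u i), p j] [f (u i), p j]"
      "list_eqv C [p j, f (u i), g (u i)] [p j, g (u i)]" if "j < N" "i = j \<or> i = Suc j" for i j
    proof -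
      have ij: "u i \<in> {0..1}" "u j \<in> {0..1}" "i \<le> N"
        using that u01 by auto
      then obtain E where E: "E \<in> G" "g (u i) \<in> E"
        using g(2) by blast
      have "dist (u i) (u j) < d"
        using that us(2)[of j] N(2) d(1) N(1) by (auto simp: dist_real_def)
      then have "dist (f (u i)) (f (u j)) < e / 2"
        using d(2) ij by blast
      then have "dist (f (u j)) (g (u i)) < e"
        using close2 ij by (metis dist_commute dist_triangle_half_r)
      then have "dist (p j) (g (u i)) < r (p j)"
        using p[of j] that by auto
      then have "p j \<in> E"
        using r(2) E by blast
      moreover have "dist (f (u i)) (g (u i)) < r (f (u i))"
        using close ij \<epsilon>(3)[of i] by fastforce
      then have "f (u i) \<in> E"
        using r(2) E by blast
      ultimately show "list_eqv C [f (u i), g (u i), p j] [f (u i), p j]"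
        "list_eqv C [p j, f (u i), g (u i)] [p j, g (u i)]"
        using segments_aligned[of E] G E by blast+
    qed
    have piece: "\<exists>ws. traverses C h (u j) (u (Suc j)) ws"
      if zh: "traverses C h 0 1 zh" and j: "j < N" for h zh j
    proof -
      obtain ws where ws: "traverses C h (u j) 1 ws"
        using traverses_split[OF zh, of "u j"] u01[of j] j by auto
      then show ?thesis
        using traverses_split[OF ws, of "u (Suc j)"] us(1)[of j] u01[of "Suc j"] j by auto
    qed
    \<comment> \<open>Up to time \<open>u n\<close>, following \<open>g\<close> amounts to following \<open>f\<close> and then crossing the \<open>n\<close>-th rung.\<close>
    have "\<exists>zs ws. traverses C f 0 (u n) zs \<and> traverses C g 0 (u n) ws \<and> list_eqv C ws (zs @ [g (u n)])"
      if "n \<le> N" for n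
      using that
    proof (induction n)
      case 0
      have "f 0 \<in> \<Union>C"
        using traverses_image[OF f(1)] by (auto simp: image_subset_iff)
      then obtain S where S: "S \<in> C" "f 0 \<in> S"
        by blast
      have "affine_on_interval 0 0 h" for h :: "real \<Rightarrow> 'a"
        by (simp add: affine_on_interval_iff algebra_simps)
      then have "traverses C f 0 0 [f 0, f 0]" "traverses C g 0 0 [f 0, f 0]"
        using S g(3) traverses.piece[of 0 0 f S C] traverses.piece[of 0 0 g S C] by auto
      moreover have "list_eqv C [f 0, f 0] ([f 0, f 0] @ [f 0])"
        by (intro list_eqv_sym[OF list_eqv_repeated_append]) auto
      ultimately show ?case
        using u(1) g(3) by metis
    next
      case (Suc n)
      then have "n < N" by simp
      obtain zs ws where IH: "traverses C f 0 (u n) zs" "traverses C g 0 (u n) ws"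
          "list_eqv C ws (zs @ [g (u n)])"
        using Suc by auto
      obtain zs' ws' where *: "traverses C f (u n) (u (Suc n)) zs'" "traverses C g (u n) (u (Suc n)) ws'"
        using piece f(1) g(1) \<open>n < N\<close> by meson
      obtain ys where ys: "zs = ys @ [f (u n)]"
        using traverses_ends[OF IH(1)] by (metis append_butlast_last_id)
      have "list_eqv C (ws @ ws') ((zs @ [g (u n)]) @ [g (u n), p n, g (u (Suc n))])"
        using IH(3) star[OF *(2) g(2) close2 \<open>n < N\<close>] by (intro list_eqv_append)
      also have "list_eqv C \<dots> (zs @ [g (u n), p n, g (u (Suc n))])"
        using list_eqv_context[OF list_eqv_repeated, of C zs "g (u n)" "[p n, g (u (Suc n))]"] by simp
      also have "list_eqv C \<dots> (ys @ [f (u n), p n] @ [g (u (Suc n))])"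
        using list_eqv_context[OF rung(1)[of n n], of ys "[g (u (Suc n))]"] \<open>n < N\<close> ys by simp
      also have "list_eqv C \<dots> (ys @ [f (u n)] @ [p n, f (u (Suc n)), g (u (Suc n))] @ [])"
        using list_eqv_context[OF list_eqv_sym[OF rung(2)[of n "Suc n"]], of "ys @ [f (u n)]" "[]"]
          \<open>n < N\<close> by simp
      also have "list_eqv C \<dots> (zs @ [f (u n), p n, f (u (Suc n))] @ [g (u (Suc n))])"
        using list_eqv_context[OF list_eqv_sym[OF list_eqv_repeated], of C ys "f (u n)"
            "[p n, f (u (Suc n)), g (u (Suc n))]"] ys by simp
      also have "list_eqv C \<dots> (zs @ zs' @ [g (u (Suc n))])"
        using star[OF *(1) f(2) ff \<open>n < N\<close>] by (rule list_eqv_context[OF list_eqv_sym])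
      finally have "list_eqv C (ws @ ws') ((zs @ zs') @ [g (u (Suc n))])"
        by simp
      then show ?case
        using IH * traverses.join by blast
    qed
    then obtain zs ws where *: "traverses C f 0 1 zs" "traverses C g 0 1 ws" "list_eqv C ws (zs @ [g 1])"
      using u(2) by (metis order_refl)
    have "list_eqv C zg ws"
      using traverses_unique g(1) *(2) by blast
    also have "list_eqv C ws (zs @ [g 1])"
      by (rule *(3))
    also have "list_eqv C \<dots> zs"
      using traverses_ends[OF *(1)] g(4) by (intro list_eqv_repeated_append) auto
    also have "list_eqv C zs zf"
      using traverses_unique f(1) *(1) by blast
    finally show ?thesis .
  qed
  then show ?thesis
    using \<epsilon>(1) by blast
qed

lemma constant_loop_traverses: "traverses C (\<lambda>t\<in>{0..1}. x0) 0 1 [x0, x0]"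
proof -
  obtain S where S: "S \<in> C" "x0 \<in> S"
    using base_point by blast
  have "affine_on_interval 0 1 (\<lambda>t\<in>{0..1}. x0)"
    unfolding affine_on_interval_def by (intro exI[of _ x0] exI[of _ 0]) simp
  moreover have "(\<lambda>t\<in>{0..1::real}. x0) ` {0..1} \<subseteq> S"
    using S by auto
  ultimately show ?thesis
    using traverses.piece[of 0 1 "\<lambda>t\<in>{0..1}. x0" S C] S by simp
qed

text \<open>All stages of the contraction are PL loops in the graph that \<open>\<gamma>\<close> traces out. By uniform continuity of
  the contraction nearby stages are uniformly close, so their vertex lists are equivalent.\<close>

lemma thin_imp_trivial:
  assumes "thin C x0 \<gamma>" "traverses C \<gamma> 0 1 zs"
  shows "list_eqv C zs [x0]"
proof -
  obtain h where *: "continuous_map (prod_topology (top_of_set {0..1::real}) (top_of_set {0..1}))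
        (top_of_set (path_image \<gamma>)) h \<and> (\<forall>x. h (0, x) = \<gamma> x) \<and> (\<forall>x. h (1, x) = (\<lambda>t\<in>{0..1}. x0) x) \<and>
        (\<forall>s\<in>{0..1}. (\<lambda>x. h (s, x)) \<in> pl_loops C x0)"
    using assms(1) unfolding thin_def homotopic_with_def by (elim exE) (rule that)
  have h0: "\<And>x. h (0, x) = \<gamma> x" and h1: "\<And>x. h (1, x) = (\<lambda>t\<in>{0..1}. x0) x"
      and hs: "\<And>s. s \<in> {0..1} \<Longrightarrow> (\<lambda>x. h (s, x)) \<in> pl_loops C x0"
    using * by blast+
  have "continuous_map (top_of_set ({0..1} \<times> {0..1})) (top_of_set (path_image \<gamma>)) h"
    using * by (simp add: prod_topology_subtopology subtopology_subtopology Times_Int_Times)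
  then have cont: "continuous_on ({0..1} \<times> {0..1}) h" and image: "h ` ({0..1} \<times> {0..1}) \<subseteq> path_image \<gamma>"
    by (auto simp: continuous_map_in_subtopology)
  obtain G where G: "finite G" "\<forall>E\<in>G. is_segment E" "\<gamma> ` {0..1} = \<Union>G"
    using traverses_image_segments[OF assms(2)] by blast
  have hG: "(\<lambda>x. h (s, x)) ` {0..1} \<subseteq> \<Union>G" if "s \<in> {0..1}" for s
    using image that G(3) unfolding path_image_def by blast
  have uc: "uniformly_continuous_on ({0..1} \<times> {0..1}) h"
    using cont by (intro compact_uniformly_continuous compact_Times) auto
  define R where "R s s' \<longleftrightarrow> (\<forall>zs ws. traverses C (\<lambda>x. h (s, x)) 0 1 zs \<longrightarrow>
      traverses C (\<lambda>x. h (s', x)) 0 1 ws \<longrightarrow> list_eqv C zs ws)" for s s'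
  have "R 0 1"
  proof (rule connected_equivalence_relation[of "{0..1}" 0 1 R])
    show "R y x" if "R x y" for x y
      using that list_eqv_sym unfolding R_def by blast
    show "R x z" if xyz: "R x y" "R y z" "y \<in> {0..1}" for x y z
    proof -
      obtain ys where "traverses C (\<lambda>x. h (y, x)) 0 1 ys"
        using hs[OF xyz(3)] by (rule pl_loops_traverses)
      then show ?thesis
        using xyz list_eqv_trans unfolding R_def by blast
    qed
    show "\<exists>T. openin (top_of_set {0..1}) T \<and> s \<in> T \<and> (\<forall>x\<in>T. R s x)" if s: "s \<in> {0..1}" for s
    proof -
      obtain zf where zf: "traverses C (\<lambda>x. h (s, x)) 0 1 zf"
        using hs[OF s] by (rule pl_loops_traverses)
      obtain e where e: "e > 0" "\<And>g zg. \<lbrakk>traverses C g 0 1 zg; g ` {0..1} \<subseteq> \<Union>G; g 0 = h (s, 0);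
          g 1 = h (s, 1); \<forall>t\<in>{0..1}. dist (h (s, t)) (g t) < e\<rbrakk> \<Longrightarrow> list_eqv C zg zf"
        using nearby_paths_eqv[OF G(1,2) zf hG[OF s]] by auto
      obtain d where d: "d > 0" "\<And>x y. x \<in> {0..1} \<times> {0..1} \<Longrightarrow> y \<in> {0..1} \<times> {0..1} \<Longrightarrow> dist y x < d
          \<Longrightarrow> dist (h y) (h x) < e"
        using uc e(1) unfolding uniformly_continuous_on_def by metis
      have "R s s'" if s': "s' \<in> {0..1}" "dist s s' < d" for s'
        unfolding R_def
      proof (intro allI impI)
        fix zs ws
        assume zs: "traverses C (\<lambda>x. h (s, x)) 0 1 zs" and ws: "traverses C (\<lambda>x. h (s', x)) 0 1 ws"
        have "h (s', 0) = h (s, 0)" "h (s', 1) = h (s, 1)"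
          using hs[OF s] hs[OF s'(1)] by (auto simp: pl_loops_iff)
        moreover have "dist (h (s, t)) (h (s', t)) < e" if "t \<in> {0..1}" for t
          using d(2)[of "(s', t)" "(s, t)"] s s' that by (simp add: dist_prod_def)
        ultimately have "list_eqv C ws zf"
          using ws hG[OF s'(1)] by (intro e(2)[of "\<lambda>x. h (s', x)"]) auto
        moreover have "list_eqv C zs zf"
          using zs zf traverses_unique by blast
        ultimately show "list_eqv C zs ws"
          using list_eqv_sym list_eqv_trans by blast
      qed
      moreover have "openin (top_of_set {0..1}) ({0..1} \<inter> ball s d)"
        by blast
      ultimately show ?thesis
        using s d(1) by (intro exI[of _ "{0..1} \<inter> ball s d"]) auto
    qed
  qed auto
  moreover have "(\<lambda>x. h (0, x)) = \<gamma>" "(\<lambda>x. h (1, x)) = (\<lambda>t\<in>{0..1}. x0)"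
    using h0 h1 by auto
  ultimately have "list_eqv C zs [x0, x0]"
    using assms(2) constant_loop_traverses unfolding R_def by metis
  then show ?thesis
    using list_eqv_repeated list_eqv_trans by blast
qed

lemma traverses_join_reverse:
  assumes "traverses C f 0 1 zf" "traverses C g 0 1 zg" "f 1 = g 1"
  shows "traverses C (f +++ reversepath g) 0 1 (zf @ rev zg)"
proof -
  have "traverses C (f +++ reversepath g) 0 (1 / 2) zf"
    using traverses_affine_substitution[OF assms(1), of 2 0 0 "1 / 2" "f +++ reversepath g"]
    by (simp add: joinpaths_def)
  moreover have "traverses C (f +++ reversepath g) (1 / 2) 1 (rev zg)"
    using traverses_affine_substitution[OF assms(2), of "-2" 2 1 "1 / 2" "f +++ reversepath g"] assms(3)
    by (simp add: joinpaths_def reversepath_def)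
      (smt (verit) mult.commute)
  ultimately show ?thesis
    by (rule traverses.join)
qed

text \<open>For one step of the chain, \<open>z\<^sub>f \<approx> z\<^sub>f z\<^sub>g\<inverse> z\<^sub>g \<approx> z\<^sub>g\<close>, where \<open>z\<^sub>f z\<^sub>g\<inverse>\<close> is the vertex list of a thin loop.\<close>

lemma thin_homotopic_imp_list_eqv:
  assumes "thin_homotopic C x0 f g" "traverses C f 0 1 zf" "traverses C g 0 1 zg"
  shows "list_eqv C zf zg"
proof -
  have step: "list_eqv C zf zg"
    if fg: "f \<in> pl_loops C x0" "g \<in> pl_loops C x0" and thin: "thin C x0 (f +++ reversepath g)"
      and zf: "traverses C f 0 1 zf" and zg: "traverses C g 0 1 zg" for f g zf zg
  proof -
    have ends: "f 1 = x0" "g 0 = x0" "g 1 = x0"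
      using fg by (auto simp: pl_loops_iff)
    have "traverses C (f +++ reversepath g) 0 1 (zf @ rev zg)"
      using zf zg ends by (intro traverses_join_reverse) auto
    then have trivial: "list_eqv C (zf @ rev zg) [x0]"
      by (rule thin_imp_trivial[OF thin])
    have "chain_in C (rev zg)"
      using traverses_chain[OF zg] by (auto simp: chain_in_def successively_rev elim: successively_mono)
    then have cancel: "list_eqv C (rev zg @ zg) [x0]"
      using list_eqv_reversal[of C "rev zg"] traverses_ends[OF zg] ends by (simp add: hd_rev)
    have "list_eqv C zf (zf @ [x0])"
      using traverses_ends[OF zf] ends by (intro list_eqv_sym[OF list_eqv_repeated_append]) auto
    also have "list_eqv C \<dots> (zf @ (rev zg @ zg))"
      by (rule list_eqv_append[OF list_eqv_refl list_eqv_sym[OF cancel]])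
    also have "list_eqv C \<dots> ([x0] @ zg)"
      using list_eqv_append[OF trivial list_eqv_refl] by simp
    also have "list_eqv C \<dots> zg"
      using traverses_ends[OF zg] ends list_eqv_repeated_prepend[of zg x0 C] by auto
    finally show ?thesis .
  qed
  obtain m c where c: "\<forall>i\<le>m. c i \<in> pl_loops C x0" "c 0 = f" "c m = g"
      "\<forall>i<m. thin C x0 (c i +++ reversepath (c (Suc i)))"
    using assms(1) unfolding thin_homotopic_def by auto
  have "\<forall>zs. traverses C (c i) 0 1 zs \<longrightarrow> list_eqv C zf zs" if "i \<le> m" for i
    using that
  proof (induction i)
    case 0
    then show ?case using c(2) assms(2) traverses_unique by blast
  next
    case (Suc i)
    then have "c i \<in> pl_loops C x0" using c by simp
    then obtain ys where "traverses C (c i) 0 1 ys"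
      by (rule pl_loops_traverses)
    with Suc show ?case
      using c step[of "c i" "c (Suc i)"] list_eqv_trans by (meson Suc_le_lessD le_SucI Suc_leD)
  qed
  then show ?thesis
    using c(3) assms(3) by blast
qed

end

section \<open>Vertex lists and tuples\<close>

definition tuple_of_list :: "'a list \<Rightarrow> nat \<times> (nat \<Rightarrow> 'a)" where
  "tuple_of_list zs = (length zs - 1, \<lambda>j\<in>{..length zs - 1}. zs ! j)"

definition loop_list :: "'a::euclidean_space set set \<Rightarrow> 'a \<Rightarrow> 'a list \<Rightarrow> bool" where
  "loop_list C x0 zs \<longleftrightarrow> chain_in C zs \<and> hd zs = x0 \<and> last zs = x0"

lemma tuple_of_list_in_tuples:
  assumes "loop_list C x0 zs"
  shows "(\<lambda>j\<in>{..length zs - 1}. zs ! j) \<in> tuples C x0 (length zs - 1)"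
proof -
  let ?k = "length zs - 1"
  have zs: "zs \<noteq> []" "set zs \<subseteq> \<Union>C" "hd zs = x0" "last zs = x0"
    using assms unfolding loop_list_def chain_in_def by blast+
  have adj: "\<exists>S\<in>C. zs ! i \<in> S \<and> zs ! Suc i \<in> S" if "i < ?k" for i
    using assms that successively_nth[of _ zs i] unfolding loop_list_def chain_in_def by fastforce
  have "zs ! i \<in> \<Union>C" if "i \<le> ?k" for i
  proof -
    have "i < length zs"
      using that zs(1) by (cases zs) auto
    then show ?thesis
      using zs(2) nth_mem by blast
  qed
  moreover have "zs ! 0 = x0" "zs ! ?k = x0"
    using zs by (simp_all add: hd_conv_nth last_conv_nth)
  ultimately show ?thesis
    unfolding tuples_def using adj by (simp add: PiE_iff)
qed

lemma delete_entry_nth: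
  assumes "0 < i" "i < length zs - 1"
  shows "delete_entry (length zs - 1) i (\<lambda>j\<in>{..length zs - 1}. zs ! j) =
    (\<lambda>j\<in>{..length zs - 2}. (take i zs @ drop (Suc i) zs) ! j)"
  using assms unfolding delete_entry_def
  by (intro ext) (auto simp: restrict_def nth_append min_def)

lemma list_move_loop_list:
  assumes "list_move C xs ys"
  shows "loop_list C x0 xs \<longleftrightarrow> loop_list C x0 ys"
  using assms
proof cases
  case (aligned S a b c us vs)
  then show ?thesis
    by (auto simp: loop_list_def chain_in_def successively_append_iff successively_Cons hd_append)
next
  case (repeated us a vs)
  then show ?thesis
    by (auto simp: loop_list_def chain_in_def successively_append_iff successively_Cons hd_append)
qed

lemma tuple_of_list_delete:
  assumes "loop_list C x0 (us @ [a, b, c] @ vs)"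
    and "S \<in> C" "{a, b, c} \<subseteq> S" "collinear {a, b, c}"
  shows "tuple_step C x0 (tuple_of_list (us @ [a, b, c] @ vs)) (tuple_of_list (us @ [a, c] @ vs))"
proof -
  let ?zs = "us @ [a, b, c] @ vs" and ?i = "Suc (length us)"
  let ?k = "length ?zs - 1"
  let ?x = "\<lambda>j\<in>{..?k}. ?zs ! j"
  have "?x (?i - 1) = a" "?x ?i = b" "?x (?i + 1) = c"
    by (auto simp: nth_append)
  then have "tuple_step C x0 (?k, ?x) (?k - 1, delete_entry ?k ?i ?x)"
    using assms tuple_of_list_in_tuples[OF assms(1)]
    by (intro tuple_step.delete[of ?x C x0 ?k ?i S]) auto
  moreover have "delete_entry ?k ?i ?x = (\<lambda>j\<in>{..length ?zs - 2}. (us @ [a, c] @ vs) ! j)"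
    by (subst delete_entry_nth) auto
  ultimately show ?thesis
    by (simp add: tuple_of_list_def)
qed

text \<open>In the vertex list of a loop a repeated entry can be deleted as an aligned interior entry, since it
  forms a degenerate triple with one of its neighbours. The only list without such a neighbour is
  \<open>[x0, x0]\<close>, which the second kind of move on tuples takes care of.\<close>

lemma list_move_tuple_rel:
  assumes "list_move C xs ys" "loop_list C x0 xs"
  shows "(tuple_of_list xs, tuple_of_list ys) \<in> tuple_rel C x0"
  using assms(1)
proof cases
  case (aligned S a b c us vs)
  then show ?thesis
    using tuple_of_list_delete[of C x0 us a b c vs S] assms(2) by (auto simp: tuple_rel_def)
next
  case (repeated us a vs)
  have *: "chain_in C xs" "hd xs = x0" "last xs = x0"
    using assms(2) by (auto simp: loop_list_def)
  consider "us = []" "vs = []" | us' z where "us = us' @ [z]" | z vs' where "vs = z # vs'"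
    by (metis rev_exhaust neq_Nil_conv)
  then show ?thesis
  proof cases
    case 1
    then have "xs = [x0, x0]" "ys = [x0]"
      using repeated * by auto
    then have "tuple_of_list xs = (1, \<lambda>j\<in>{..1}. x0)" "tuple_of_list ys = (0, \<lambda>j\<in>{..0}. x0)"
      by (auto simp: tuple_of_list_def restrict_def le_Suc_eq fun_eq_iff)
    then show ?thesis
      using tuple_step.trivial[of C x0] by (auto simp: tuple_rel_def)
  next
    case (2 us' z)
    then obtain S where "S \<in> C" "z \<in> S" "a \<in> S"
      using repeated * by (auto simp: chain_in_def successively_append_iff)
    then show ?thesis
      using tuple_of_list_delete[of C x0 us' z a a vs S] repeated 2 assms(2)
      by (auto simp: tuple_rel_def)
  next
    case (3 z vs')
    then obtain S where "S \<in> C" "z \<in> S" "a \<in> S"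
      using repeated * by (auto simp: chain_in_def successively_append_iff)
    then show ?thesis
      using tuple_of_list_delete[of C x0 us a a z vs' S] repeated 3 assms(2)
      by (auto simp: tuple_rel_def)
  qed
qed

lemma list_eqv_tuple_rel:
  assumes "list_eqv C xs ys" "loop_list C x0 xs"
  shows "(tuple_of_list xs, tuple_of_list ys) \<in> tuple_rel C x0"
proof -
  have "loop_list C x0 ys \<and> (tuple_of_list xs, tuple_of_list ys) \<in> tuple_rel C x0"
    using assms(1) unfolding list_eqv_def
  proof (induction rule: equivclp_induct)
    case base
    then show ?case using assms(2) by (simp add: tuple_rel_def)
  next
    case (step y z)
    then have z: "loop_list C x0 z"
      using list_move_loop_list by blast
    with step have "(tuple_of_list y, tuple_of_list z) \<in> tuple_rel C x0 \<or>
        (tuple_of_list z, tuple_of_list y) \<in> tuple_rel C x0"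
      using list_move_tuple_rel by blast
    then have "(tuple_of_list y, tuple_of_list z) \<in> tuple_rel C x0"
      by (auto simp: tuple_rel_def intro: equivclp_sym)
    with z step.IH show ?case
      unfolding tuple_rel_def by (auto intro: equivp_transp[OF equivp_evquivclp])
  qed
  then show ?thesis ..
qed

section \<open>Polygonal paths\<close>

definition hat :: "real \<Rightarrow> real" where
  "hat u = max 0 (1 - \<bar>u\<bar>)"

text \<open>The hat functions are a partition of unity, so for \<open>k > 0\<close> this is the path through \<open>x i\<close> at time
  \<open>i / k\<close> that is affine in between, and for \<open>k = 0\<close> it is constant. The formula makes linearity in \<open>x\<close>
  evident. For a real tuple the same function serves as a PL reparametrisation.\<close>

definition polygon :: "nat \<Rightarrow> (nat \<Rightarrow> 'a::real_vector) \<Rightarrow> real \<Rightarrow> 'a" where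
  "polygon k x = (\<lambda>t\<in>{0..1}. \<Sum>i\<le>k. hat (real k * t - real i) *\<^sub>R x i)"

lemma polygon_extensional: "polygon k x \<in> extensional {0..1}"
  by (simp add: polygon_def)

lemma polygon_cong: "(\<And>i. i \<le> k \<Longrightarrow> x i = y i) \<Longrightarrow> polygon k x = polygon k y"
  by (auto simp: polygon_def intro!: restrict_ext sum.cong)

lemma polygon_0: "polygon 0 x = (\<lambda>t\<in>{0..1}. x 0)"
  by (auto simp: polygon_def hat_def)

lemma polygon_piece:
  assumes "i < k" "u \<in> {0..1}"
  shows "polygon k x ((real i + u) / real k) = (1 - u) *\<^sub>R x i + u *\<^sub>R x (Suc i)"
proof -
  have k: "real k * ((real i + u) / real k) = real i + u"
    using assms by simp
  have "(real i + u) / real k \<in> {0..1}"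
    using assms by (auto simp: divide_le_eq)
  then have "polygon k x ((real i + u) / real k) = (\<Sum>j\<le>k. hat (real i + u - real j) *\<^sub>R x j)"
    by (simp only: polygon_def restrict_apply' k)
  also have "\<dots> = (\<Sum>j\<in>{i, Suc i}. hat (real i + u - real j) *\<^sub>R x j)"
  proof (rule sum.mono_neutral_right)
    show "\<forall>j\<in>{..k} - {i, Suc i}. hat (real i + u - real j) *\<^sub>R x j = 0"
    proof
      fix j assume "j \<in> {..k} - {i, Suc i}"
      then have "j < i \<or> Suc i < j" by auto
      then have "real j + 1 \<le> real i \<or> real i + 2 \<le> real j" by linarith
      then have "1 \<le> \<bar>real i + u - real j\<bar>"
        using assms(2) by auto
      then show "hat (real i + u - real j) *\<^sub>R x j = 0"
        by (simp add: hat_def)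
    qed
  qed (use assms in auto)
  also have "\<dots> = (1 - u) *\<^sub>R x i + u *\<^sub>R x (Suc i)"
    using assms(2) by (simp add: hat_def)
  finally show ?thesis .
qed

lemma unit_interval_piece:
  fixes t :: real
  assumes "0 < k" "t \<in> {0..1}"
  obtains i u where "i < k" "u \<in> {0..1}" "t = (real i + u) / real k"
proof (cases "t = 1")
  case True
  then show ?thesis
    using assms that[of "k - 1" 1] by (auto simp: of_nat_diff)
next
  case False
  define i where "i = nat \<lfloor>real k * t\<rfloor>"
  have i: "real i \<le> real k * t" "real k * t < real i + 1"
    using assms unfolding i_def by (simp_all add: of_nat_nat)
  have "real k * t < real k"
    using False assms by auto
  then have "i < k"
    using i(1) by linarith
  moreover have "t = (real i + (real k * t - real i)) / real k"
    using assms by simp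
  ultimately show ?thesis
    using i by (intro that[of i "real k * t - real i"]) auto
qed

lemma polygon_vertex:
  assumes "0 < k" "i \<le> k"
  shows "polygon k x (real i / real k) = x i"
proof (cases "i = k")
  case True
  then show ?thesis
    using polygon_piece[of "k - 1" k 1 x] assms by (simp add: of_nat_diff)
next
  case False
  then show ?thesis
    using polygon_piece[of i k 0 x] assms by simp
qed

lemma polygon_start: "polygon k x 0 = x 0"
  using polygon_vertex[of k 0 x] by (cases "k = 0") (simp_all add: polygon_0)

lemma polygon_end: "polygon k x 1 = x k"
proof (cases "k = 0")
  case True
  then show ?thesis by (simp add: polygon_0)
next
  case False
  then have "real k / real k = 1" by simp
  then show ?thesis
    using polygon_vertex[of k k x] False by (metis neq0_conv order_refl)
qed

lemma polygon_piece_eq: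
  assumes "i < k" "u \<in> {0..1}"
  shows "polygon k x ((1 - u) * (real i / real k) + u * (real (Suc i) / real k)) =
    (1 - u) *\<^sub>R x i + u *\<^sub>R x (Suc i)"
proof -
  have "(1 - u) * (real i / real k) + u * (real (Suc i) / real k) = (real i + u) / real k"
    using assms by (simp add: field_simps)
  then show ?thesis
    using polygon_piece[OF assms] by simp
qed

lemma polygon_affine_piece:
  assumes "i < k"
  shows "affine_on_interval (real i / real k) (real (Suc i) / real k) (polygon k x)"
proof -
  have "real i / real k \<le> real (Suc i) / real k"
    by (intro divide_right_mono) auto
  moreover have "polygon k x (real i / real k) = x i" "polygon k x (real (Suc i) / real k) = x (Suc i)"
    using assms by (simp_all add: polygon_vertex del: of_nat_Suc)
  ultimately show ?thesis
    unfolding affine_on_interval_iff[OF \<open>real i / real k \<le> real (Suc i) / real k\<close>]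
    using polygon_piece_eq[OF assms, of _ x] by metis
qed

lemma interval_convex_combination:
  fixes a b t :: real
  assumes "t \<in> {a..b}"
  obtains u where "u \<in> {0..1}" "t = (1 - u) * a + u * b"
proof (cases "a = b")
  case True
  with assms show ?thesis
    by (intro that[of 0]) auto
next
  case False
  define u where "u = (t - a) / (b - a)"
  have "a < b" using False assms by simp
  then have "u * (b - a) = t - a"
    by (simp add: u_def)
  then have "t = (1 - u) * a + u * b"
    by (simp add: algebra_simps)
  moreover have "u \<in> {0..1}"
    using \<open>a < b\<close> assms by (auto simp: u_def)
  ultimately show ?thesis using that by blast
qed

lemma polygon_piece_image:
  assumes "i < k" "convex S" "x i \<in> S" "x (Suc i) \<in> S"
  shows "polygon k x ` {real i / real k..real (Suc i) / real k} \<subseteq> S"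
proof (rule image_subsetI)
  fix t assume "t \<in> {real i / real k..real (Suc i) / real k}"
  then obtain u where u: "u \<in> {0..1}" "t = (1 - u) * (real i / real k) + u * (real (Suc i) / real k)"
    by (rule interval_convex_combination)
  then show "polygon k x t \<in> S"
    using polygon_piece_eq[OF assms(1) u(1), of x] convexD_alt[OF assms(2-4)] by auto
qed

lemma polygon_in_convex:
  assumes "convex S" "\<And>i. i \<le> k \<Longrightarrow> x i \<in> S" "t \<in> {0..1}"
  shows "polygon k x t \<in> S"
proof (cases "k = 0")
  case True
  then show ?thesis using assms by (simp add: polygon_0)
next
  case False
  with assms(3) obtain i u where "i < k" "u \<in> {0..1}" "t = (real i + u) / real k"
    by (meson unit_interval_piece neq0_conv)
  then show ?thesis
    using polygon_piece[of i k u x] convexD_alt[OF assms(1), of "x i" "x (Suc i)" u] assms(2) by auto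
qed

lemma polygon_traverses:
  assumes "0 < k" "\<And>i. i < k \<Longrightarrow> \<exists>S\<in>E. convex S \<and> x i \<in> S \<and> x (Suc i) \<in> S"
  shows "\<exists>zs. traverses E (polygon k x) 0 1 zs \<and> list_eqv E zs (map x [0..<Suc k])"
proof -
  have "real i / real k \<le> real (Suc i) / real k \<and>
      affine_on_interval (real i / real k) (real (Suc i) / real k) (polygon k x) \<and>
      (\<exists>S\<in>E. polygon k x ` {real i / real k..real (Suc i) / real k} \<subseteq> S)" if "i < k" for i
    using polygon_affine_piece[OF that] polygon_piece_image[OF that, of _ x] assms(2)[OF that]
    by (meson divide_right_mono of_nat_0_le_iff of_nat_le_iff lessI less_imp_le)
  then obtain zs where "traverses E (polygon k x) (real 0 / real k) (real k / real k) zs"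
      "list_eqv E zs (map (polygon k x \<circ> (\<lambda>i. real i / real k)) [0..<Suc k])"
    using subdivision_traverses[of k "\<lambda>i. real i / real k" "polygon k x" E] assms(1) by blast
  moreover have "map (polygon k x \<circ> (\<lambda>i. real i / real k)) [0..<Suc k] = map x [0..<Suc k]"
    using assms(1) by (intro map_cong) (auto simp: polygon_vertex polygon_end)
  moreover have "real 0 / real k = 0" "real k / real k = 1"
    using assms(1) by auto
  ultimately show ?thesis
    by metis
qed

lemma polygon_continuous:
  fixes x :: "nat \<Rightarrow> 'a::real_normed_vector"
  shows "continuous_on {0..1} (polygon k x)"
proof -
  have "continuous_on {0..1} (\<lambda>t. \<Sum>i\<le>k. hat (real k * t - real i) *\<^sub>R x i)"
    unfolding hat_def by (intro continuous_intros)
  then show ?thesis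
    by (simp add: polygon_def cong: continuous_on_cong_simp)
qed

lemma polygon_combination:
  assumes "t \<in> {0..1}"
  shows "polygon k (\<lambda>i. (1 - s) *\<^sub>R x i + s *\<^sub>R y i) t = (1 - s) *\<^sub>R polygon k x t + s *\<^sub>R polygon k y t"
  using assms by (simp add: polygon_def scaleR_add_right sum.distrib scaleR_sum_right mult.commute)

lemma polygon_identity:
  assumes "0 < k" "t \<in> {0..1}"
  shows "polygon k (\<lambda>i. real i / real k) t = t"
proof -
  obtain i u where *: "i < k" "u \<in> {0..1}" "t = (real i + u) / real k"
    using unit_interval_piece[OF assms] .
  have "polygon k (\<lambda>i. real i / real k) t = (1 - u) * (real i / real k) + u * (real (Suc i) / real k)"
    unfolding *(3) using polygon_piece[OF *(1,2), of "\<lambda>i. real i / real k"] by simp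
  also have "\<dots> = (real i + u) / real k"
    using assms(1) by (simp add: field_simps)
  also have "\<dots> = t"
    using *(3) by simp
  finally show ?thesis .
qed

lemma polygon_dist:
  fixes x y :: "nat \<Rightarrow> 'a::real_normed_vector"
  assumes "t \<in> {0..1}"
  shows "dist (polygon k x t) (polygon k y t) \<le> (\<Sum>i\<le>k. dist (x i) (y i))"
proof -
  have "polygon k x t - polygon k y t = (\<Sum>i\<le>k. hat (real k * t - real i) *\<^sub>R (x i - y i))"
    using assms by (simp add: polygon_def scaleR_diff_right sum_subtractf)
  also have "norm \<dots> \<le> (\<Sum>i\<le>k. norm (hat (real k * t - real i) *\<^sub>R (x i - y i)))"
    by (rule norm_sum)
  also have "\<dots> \<le> (\<Sum>i\<le>k. norm (x i - y i))"
    by (intro sum_mono) (auto simp: hat_def intro!: mult_left_le_one_le)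
  finally show ?thesis
    by (simp add: dist_norm)
qed

lemma polygon_substitution:
  assumes "0 < k" "s \<in> {0..1}"
    and "\<And>i. i < k \<Longrightarrow> t i \<le> t (Suc i) \<and> affine_on_interval (t i) (t (Suc i)) f"
  shows "polygon k (f \<circ> t) s = f (polygon k t s)"
proof -
  obtain i u where *: "i < k" "u \<in> {0..1}" "s = (real i + u) / real k"
    using unit_interval_piece[OF assms(1,2)] .
  then show ?thesis
    using assms(3)[OF *(1)] polygon_piece[OF *(1,2), of "f \<circ> t"] polygon_piece[OF *(1,2), of t]
    by (auto simp: affine_on_interval_iff)
qed

context convex_cover
begin

lemma polygon_in_pl_loops:
  assumes "x \<in> tuples C x0 k"
  shows "polygon k x \<in> pl_loops C x0"
proof -
  have ends: "x 0 = x0" "x k = x0" and adj: "\<And>i. i < k \<Longrightarrow> \<exists>S\<in>C. x i \<in> S \<and> x (Suc i) \<in> S"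
    using assms by (auto simp: tuples_def)
  have "\<exists>zs. traverses C (polygon k x) 0 1 zs"
  proof (cases "k = 0")
    case True
    then show ?thesis
      using constant_loop_traverses ends by (auto simp: polygon_0)
  next
    case False
    then show ?thesis
      using polygon_traverses[of k C x] adj convex_cell by blast
  qed
  then show ?thesis
    by (simp add: pl_loops_iff polygon_extensional polygon_start polygon_end ends)
qed

lemma compose_polygon_in_pl_loops:
  assumes "\<gamma> \<in> pl_loops C x0" "0 < k" "\<And>i. i \<le> k \<Longrightarrow> u i \<in> {0..1}" "\<gamma> (u 0) = x0" "\<gamma> (u k) = x0"
  shows "(\<lambda>t\<in>{0..1}. \<gamma> (polygon k u t)) \<in> pl_loops C x0"
proof -
  obtain zs where zs: "traverses C \<gamma> 0 1 zs"
    using assms(1) by (rule pl_loops_traverses)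
  obtain us where "traverses {UNIV} (polygon k u) 0 1 us"
    using polygon_traverses[of k "{UNIV}" u] assms(2) by auto
  moreover have "polygon k u ` {0..1} \<subseteq> {0..1}"
    using assms(3) by (auto intro!: polygon_in_convex[of "{0..1}"] simp del: atLeastAtMost_iff)
  ultimately obtain ws where "traverses C (\<gamma> \<circ> polygon k u) 0 1 ws"
    using traverses_compose[OF _ zs] by blast
  then have "traverses C (\<lambda>t\<in>{0..1}. \<gamma> (polygon k u t)) 0 1 ws"
    using traverses_affine_substitution[of C "\<gamma> \<circ> polygon k u" 0 1 ws 1 0 0 1] by simp
  then show ?thesis
    using assms by (auto simp: pl_loops_iff polygon_start polygon_end)
qed

lemma join_reverse_in_pl_loops:
  assumes "f \<in> pl_loops C x0" "g \<in> pl_loops C x0"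
  shows "f +++ reversepath g \<in> pl_loops C x0"
proof -
  obtain zf zg where "traverses C f 0 1 zf" "traverses C g 0 1 zg"
    using assms pl_loops_traverses by metis
  then have "traverses C (f +++ reversepath g) 0 1 (zf @ rev zg)"
    using assms by (intro traverses_join_reverse) (auto simp: pl_loops_iff)
  then show ?thesis
    using assms by (auto simp: pl_loops_iff extensional_joinpaths extensional_reversepath)
      (auto simp: joinpaths_def reversepath_def)
qed

lemma reverse_in_pl_loops:
  assumes "f \<in> pl_loops C x0"
  shows "reversepath f \<in> pl_loops C x0"
proof -
  obtain zf where zf: "traverses C f 0 1 zf"
    using assms pl_loops_traverses by metis
  have "traverses C (reversepath f) 0 1 (rev zf)"
    using traverses_affine_substitution[OF zf, of "-1" 1 1 0 "reversepath f"]
    by (simp add: reversepath_def)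
  moreover have "reversepath f \<in> extensional {0..1}"
    using assms by (intro extensional_reversepath) (auto simp: pl_loops_iff)
  ultimately show ?thesis
    using assms by (auto simp: pl_loops_iff) (auto simp: reversepath_def)
qed

lemma pl_loop_path:
  assumes "f \<in> pl_loops C x0"
  shows "path f" "pathstart f = x0" "pathfinish f = x0"
  using assms by (auto simp: pl_loops_def piecewise_linear_path_def)

section \<open>Elementary thin homotopies\<close>

lemma homotopic_pl_loopsI:
  fixes H :: "real \<Rightarrow> real \<Rightarrow> 'a"
  assumes "continuous_on ({0..1} \<times> {0..1}) (\<lambda>(s, t). H s t)"
    and "\<And>s t. s \<in> {0..1} \<Longrightarrow> t \<in> {0..1} \<Longrightarrow> H s t \<in> G"
    and "\<And>s. s \<in> {0..1} \<Longrightarrow> H s \<in> pl_loops C x0"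
    and "H 0 = f" "H 1 = g"
  shows "homotopic_with_canon (\<lambda>h. h \<in> pl_loops C x0) {0..1} G f g"
  unfolding homotopic_with_def
proof (intro exI[of _ "\<lambda>(s, t). H s t"] conjI)
  show "continuous_map (prod_topology (top_of_set {0..1}) (top_of_set {0..1})) (top_of_set G) (\<lambda>(s, t). H s t)"
    using assms(1,2)
    by (auto simp: prod_topology_subtopology subtopology_subtopology Times_Int_Times
        continuous_map_in_subtopology)
qed (use assms in auto)

text \<open>Interpolate the two parameter changes linearly; all stages have their values in the image of \<open>f\<close>.\<close>

lemma homotopic_reparametrisations:
  assumes "f \<in> pl_loops C x0" "0 < k"
    and u: "\<And>i. i \<le> k \<Longrightarrow> u i \<in> {0..1}" and v: "\<And>i. i \<le> k \<Longrightarrow> v i \<in> {0..1}"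
    and ends: "u 0 = v 0" "u k = v k" "f (u 0) = x0" "f (u k) = x0"
  shows "homotopic_with_canon (\<lambda>h. h \<in> pl_loops C x0) {0..1} (path_image f)
    (\<lambda>t\<in>{0..1}. f (polygon k u t)) (\<lambda>t\<in>{0..1}. f (polygon k v t))"
proof -
  let ?w = "\<lambda>s i. (1 - s) *\<^sub>R u i + s *\<^sub>R v i"
  let ?H = "\<lambda>s. \<lambda>t\<in>{0..1}. f (polygon k (?w s) t)"
  have w: "?w s i \<in> {0..1}" if "s \<in> {0..1}" "i \<le> k" for s i
    using convexD_alt[of "{0..1::real}" "u i" "v i" s] u[OF that(2)] v[OF that(2)] that(1)
    by (simp del: atLeastAtMost_iff) auto
  then have range: "polygon k (?w s) t \<in> {0..1}" if "s \<in> {0..1}" "t \<in> {0..1}" for s t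
    using that by (intro polygon_in_convex) (auto simp del: atLeastAtMost_iff)
  have 2: "?H s t \<in> path_image f" if "s \<in> {0..1}" "t \<in> {0..1}" for s t
    using range[OF that] that by (simp add: path_image_def del: atLeastAtMost_iff)
  have 3: "?H s \<in> pl_loops C x0" if "s \<in> {0..1}" for s
    using assms w[OF that] by (intro compose_polygon_in_pl_loops) (auto simp: algebra_simps)
  have "continuous_on ({0..1} \<times> {0..1}) (\<lambda>z. polygon k u (snd z))"
    and "continuous_on ({0..1} \<times> {0..1}) (\<lambda>z. polygon k v (snd z))"
    by (intro continuous_on_compose2[OF polygon_continuous] continuous_intros; auto)+
  then have "continuous_on ({0..1} \<times> {0..1})
      (\<lambda>z. (1 - fst z) *\<^sub>R polygon k u (snd z) + fst z *\<^sub>R polygon k v (snd z))"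
    by (intro continuous_intros)
  then have "continuous_on ({0..1} \<times> {0..1}) (\<lambda>z. polygon k (?w (fst z)) (snd z))"
    by (rule continuous_on_eq) (simp only: polygon_combination mem_Times_iff)
  then have "continuous_on ({0..1} \<times> {0..1}) (\<lambda>z. f (polygon k (?w (fst z)) (snd z)))"
    using range by (intro continuous_on_compose2[OF pl_loop_path(1)[OF assms(1), unfolded path_def]])
      (auto simp del: atLeastAtMost_iff)
  then have 1: "continuous_on ({0..1} \<times> {0..1}) (\<lambda>(s, t). ?H s t)"
    by (rule continuous_on_eq) auto
  show ?thesis
    by (rule homotopic_pl_loopsI[of ?H, OF 1 2 3]) simp_all
qed

text \<open>The loop \<open>f \<circ> f\<inverse>\<close> is \<open>f\<close> composed with a tent function, which can be scaled down to zero.\<close>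

lemma homotopic_back_and_forth:
  assumes "f \<in> pl_loops C x0"
  shows "homotopic_with_canon (\<lambda>h. h \<in> pl_loops C x0) {0..1} (path_image f)
    (f +++ reversepath f) (\<lambda>t\<in>{0..1}. x0)"
proof -
  let ?tent = "\<lambda>i::nat. if i = 1 then 1 else 0 :: real"
  have f0: "f 0 = x0"
    using assms by (simp add: pl_loops_iff)
  have tent: "polygon 2 ?tent t = (if t \<le> 1 / 2 then 2 * t else 2 - 2 * t)" if "t \<in> {0..1}" for t
    using that by (auto simp: polygon_def hat_def numeral_2_eq_2)
  have "f +++ reversepath f = (\<lambda>t\<in>{0..1}. f (polygon 2 ?tent t))"
  proof
    fix t
    have "f +++ reversepath f \<in> extensional {0..1}"
      using assms by (intro extensional_joinpaths extensional_reversepath) (auto simp: pl_loops_iff)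
    then show "(f +++ reversepath f) t = (\<lambda>t\<in>{0..1}. f (polygon 2 ?tent t)) t"
      using tent[of t] by (cases "t \<in> {0..1}")
        (auto simp: joinpaths_def reversepath_def extensional_def algebra_simps)
  qed
  moreover have "(\<lambda>t\<in>{0..1}. x0) = (\<lambda>t\<in>{0..1}. f (polygon 2 (\<lambda>i. 0) t))"
    using f0 by (auto simp: polygon_def)
  ultimately show ?thesis
    using homotopic_reparametrisations[OF assms, of 2 ?tent "\<lambda>i. 0"] f0 by simp
qed

text \<open>Within the image of \<open>f\<close>, first move \<open>g\<close> back to \<open>f\<close> and then contract \<open>f \<circ> f\<inverse>\<close>.\<close>

lemma thin_join_reverse:
  assumes "homotopic_with_canon (\<lambda>h. h \<in> pl_loops C x0) {0..1} (path_image f) f g"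
  shows "thin C x0 (f +++ reversepath g)"
proof -
  have fg: "f \<in> pl_loops C x0" "g \<in> pl_loops C x0"
    using homotopic_with_imp_property[OF assms] by auto
  have "pathfinish f = pathstart (reversepath g)"
    using fg pl_loop_path by simp
  then have sub: "path_image f \<subseteq> path_image (f +++ reversepath g)"
    by (simp add: path_image_join)
  have "homotopic_with_canon (\<lambda>h. h \<in> pl_loops C x0) {0..1} (path_image f) g f"
    using assms by (rule homotopic_with_symD)
  then obtain h where h: "continuous_map (prod_topology (top_of_set {0..1::real}) (top_of_set {0..1}))
        (top_of_set (path_image f)) h \<and> (\<forall>x. h (0, x) = g x) \<and> (\<forall>x. h (1, x) = f x) \<and>
        (\<forall>s\<in>{0..1}. (\<lambda>x. h (s, x)) \<in> pl_loops C x0)"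
    unfolding homotopic_with_def by (elim exE) (rule that)
  then have "continuous_map (top_of_set ({0..1} \<times> {0..1})) (top_of_set (path_image f)) h"
    by (simp add: prod_topology_subtopology subtopology_subtopology Times_Int_Times)
  then have cont: "continuous_on ({0..1} \<times> {0..1}) h" and image: "h ` ({0..1} \<times> {0..1}) \<subseteq> path_image f"
    by (auto simp: continuous_map_in_subtopology)
  have hs: "(\<lambda>x. h (s, x)) \<in> pl_loops C x0" if "s \<in> {0..1}" for s
    using h that by blast
  let ?H = "\<lambda>s. f +++ reversepath (\<lambda>x. h (s, x))"
  have "homotopic_with_canon (\<lambda>h. h \<in> pl_loops C x0) {0..1} (path_image f)
      (f +++ reversepath g) (f +++ reversepath f)"
  proof (rule homotopic_pl_loopsI[of ?H])
    show "?H s \<in> pl_loops C x0" if "s \<in> {0..1}" for s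
      using fg hs[OF that] by (intro join_reverse_in_pl_loops)
    show "?H s t \<in> path_image f" if "s \<in> {0..1}" "t \<in> {0..1}" for s t
    proof (cases "t \<le> 1 / 2")
      case True
      then show ?thesis using that by (auto simp: joinpaths_def path_image_def)
    next
      case False
      then have "(s, 1 - (2 * t - 1)) \<in> {0..1} \<times> {0..1}"
        using that by auto
      then have "h (s, 1 - (2 * t - 1)) \<in> path_image f"
        using image by blast
      with False show ?thesis by (simp add: joinpaths_def reversepath_def)
    qed
    have 1: "continuous_on ({0..1} \<times> {0..1 / 2}) (\<lambda>z. f (2 * snd z))"
      using pl_loop_path(1)[OF fg(1)] unfolding path_def
      by (rule continuous_on_compose2) (auto intro!: continuous_intros)
    have 2: "continuous_on ({0..1} \<times> {1 / 2..1}) (\<lambda>z. h (fst z, 1 - (2 * snd z - 1)))"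
      by (rule continuous_on_compose2[OF cont]) (auto intro!: continuous_intros)
    have mid: "f 1 = h (s, 1)" if "s \<in> {0..1}" for s
      using hs[OF that] fg by (simp add: pl_loops_iff)
    have "continuous_on ({0..1} \<times> {0..1 / 2} \<union> {0..1} \<times> {1 / 2..1})
        (\<lambda>z. if snd z \<le> 1 / 2 then f (2 * snd z) else h (fst z, 1 - (2 * snd z - 1)))"
    proof (rule continuous_on_cases[OF _ _ 1 2])
      show "\<forall>z. z \<in> {0..1} \<times> {0..1 / 2} \<and> \<not> snd z \<le> 1 / 2 \<or> z \<in> {0..1} \<times> {1 / 2..1} \<and> snd z \<le> 1 / 2 \<longrightarrow>
          f (2 * snd z) = h (fst z, 1 - (2 * snd z - 1))"
      proof (intro allI impI)
        fix z :: "real \<times> real"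
        assume "z \<in> {0..1} \<times> {0..1 / 2} \<and> \<not> snd z \<le> 1 / 2 \<or> z \<in> {0..1} \<times> {1 / 2..1} \<and> snd z \<le> 1 / 2"
        then have "fst z \<in> {0..1}" "snd z = 1 / 2" by auto
        then show "f (2 * snd z) = h (fst z, 1 - (2 * snd z - 1))"
          using mid[of "fst z"] by (simp only:) simp
      qed
    qed (auto intro: closed_Times)
    moreover have "{0..1} \<times> {0..1 / 2} \<union> {0..1} \<times> {1 / 2..1} = {0..1::real} \<times> {0..1::real}"
      by auto
    ultimately show "continuous_on ({0..1} \<times> {0..1}) (\<lambda>(s, t). ?H s t)"
      by (simp add: joinpaths_def reversepath_def case_prod_unfold)
    show "?H 0 = f +++ reversepath g" "?H 1 = f +++ reversepath f"
      using h by auto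
  qed
  then have "homotopic_with_canon (\<lambda>h. h \<in> pl_loops C x0) {0..1} (path_image f)
      (f +++ reversepath g) (\<lambda>t\<in>{0..1}. x0)"
    using homotopic_back_and_forth[OF fg(1)] by (rule homotopic_with_trans)
  then show ?thesis
    unfolding thin_def using sub by (rule homotopic_with_subset_right)
qed

lemma thin_reverse:
  assumes "thin C x0 \<gamma>"
  shows "thin C x0 (reversepath \<gamma>)"
proof -
  have "homotopic_with_canon (\<lambda>h. h \<in> pl_loops C x0) {0..1} (path_image \<gamma>)
      (\<gamma> \<circ> (\<lambda>t. 1 - t)) ((\<lambda>t\<in>{0..1}. x0) \<circ> (\<lambda>t. 1 - t))"
    using assms unfolding thin_def
  proof (rule homotopic_with_compose_continuous_map_right)
    show "continuous_map (top_of_set {0..1}) (top_of_set {0..1}) (\<lambda>t::real. 1 - t)"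
      by (auto intro!: continuous_intros)
    show "j \<circ> (\<lambda>t. 1 - t) \<in> pl_loops C x0" if "j \<in> pl_loops C x0" for j
      using reverse_in_pl_loops[OF that] by (simp add: reversepath_def comp_def)
  qed
  moreover have "(\<lambda>t\<in>{0..1}. x0) \<circ> (\<lambda>t. 1 - t) = (\<lambda>t\<in>{0..1::real}. x0)"
    by (auto simp: restrict_def)
  moreover have "\<gamma> \<circ> (\<lambda>t. 1 - t) = reversepath \<gamma>"
    by (simp add: reversepath_def comp_def)
  ultimately show ?thesis
    by (simp add: thin_def)
qed

section \<open>Thin homotopy as an equivalence relation\<close>

definition thin_step :: "(real \<Rightarrow> 'a) \<Rightarrow> (real \<Rightarrow> 'a) \<Rightarrow> bool" where
  "thin_step f g \<longleftrightarrow> f \<in> pl_loops C x0 \<and> g \<in> pl_loops C x0 \<and> thin C x0 (f +++ reversepath g)"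

lemma thin_homotopic_iff:
  "thin_homotopic C x0 f g \<longleftrightarrow> f \<in> pl_loops C x0 \<and> thin_step\<^sup>*\<^sup>* f g"
proof
  assume "thin_homotopic C x0 f g"
  then obtain m c where c: "\<forall>i\<le>m. c i \<in> pl_loops C x0" "c 0 = f" "c m = g"
      "\<forall>i<m. thin C x0 (c i +++ reversepath (c (Suc i)))"
    unfolding thin_homotopic_def by auto
  then have "(thin_step ^^ m) f g"
    unfolding relpowp_fun_conv by (intro exI[of _ c]) (auto simp: thin_step_def)
  with c show "f \<in> pl_loops C x0 \<and> thin_step\<^sup>*\<^sup>* f g"
    by (auto simp: relpowp_imp_rtranclp)
next
  assume *: "f \<in> pl_loops C x0 \<and> thin_step\<^sup>*\<^sup>* f g"
  then obtain m where "(thin_step ^^ m) f g"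
    by (auto simp: rtranclp_power)
  then obtain c where c: "c 0 = f" "c m = g" "\<And>i. i < m \<Longrightarrow> thin_step (c i) (c (Suc i))"
    unfolding relpowp_fun_conv by blast
  have "c i \<in> pl_loops C x0" if "i \<le> m" for i
    using that * c by (cases i) (auto simp: thin_step_def)
  with c show "thin_homotopic C x0 f g"
    unfolding thin_homotopic_def by (intro exI[of _ m] exI[of _ c]) (auto simp: thin_step_def)
qed

lemma thin_homotopic_in_pl_loops:
  assumes "thin_homotopic C x0 f g"
  shows "f \<in> pl_loops C x0" "g \<in> pl_loops C x0"
  using assms unfolding thin_homotopic_def by auto

lemma thin_homotopic_refl: "f \<in> pl_loops C x0 \<Longrightarrow> thin_homotopic C x0 f f"
  by (simp add: thin_homotopic_iff)

lemma thin_homotopic_trans [trans]: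
  "thin_homotopic C x0 f g \<Longrightarrow> thin_homotopic C x0 g h \<Longrightarrow> thin_homotopic C x0 f h"
  by (auto simp: thin_homotopic_iff)

lemma thin_homotopic_sym:
  assumes "thin_homotopic C x0 f g"
  shows "thin_homotopic C x0 g f"
proof -
  have "thin_step g f" if "thin_step f g" for f g
  proof -
    have "pathfinish f = pathstart (reversepath g)"
      using that pl_loop_path by (simp add: thin_step_def)
    then have "reversepath (f +++ reversepath g) = g +++ reversepath f"
      by (simp add: reversepath_joinpaths)
    then show ?thesis
      using that thin_reverse[of "f +++ reversepath g"] by (auto simp: thin_step_def)
  qed
  then have "symp thin_step"
    by (rule sympI)
  then have "symp thin_step\<^sup>*\<^sup>*"
    by (rule symp_rtranclp)
  then show ?thesis
    using assms thin_homotopic_in_pl_loops[OF assms] by (auto simp: thin_homotopic_iff dest: sympD)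
qed

lemma homotopic_imp_thin_homotopic:
  assumes "homotopic_with_canon (\<lambda>h. h \<in> pl_loops C x0) {0..1} (path_image f) f g"
  shows "thin_homotopic C x0 f g"
  using thin_join_reverse[OF assms] homotopic_with_imp_property[OF assms]
  by (auto simp: thin_homotopic_iff thin_step_def)

text \<open>Where \<open>\<gamma>\<close> is affine between consecutive \<open>t i\<close>, the polygon through the points \<open>\<gamma> (t i)\<close> is \<open>\<gamma>\<close>
  precomposed with the real polygon through the \<open>t i\<close>.\<close>

lemma thin_homotopic_polygon:
  assumes \<gamma>: "\<gamma> \<in> pl_loops C x0" and "0 < k" "t 0 = 0" "t k = 1"
    and t: "\<And>i. i < k \<Longrightarrow> t i \<le> t (Suc i) \<and> affine_on_interval (t i) (t (Suc i)) \<gamma>"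
  shows "thin_homotopic C x0 \<gamma> (polygon k (\<gamma> \<circ> t))"
proof (rule homotopic_imp_thin_homotopic)
  have mono: "t i \<le> t j" if "i \<le> j" "j \<le> k" for i j
    using that t by (induction j rule: dec_induct) (auto intro: order_trans)
  have t01: "t i \<in> {0..1}" if "i \<le> k" for i
    using mono[of 0 i] mono[of i k] that assms(3,4) by auto
  have "(\<lambda>s\<in>{0..1}. \<gamma> (polygon k (\<lambda>i. real i / real k) s)) = \<gamma>"
    using \<gamma> \<open>0 < k\<close> by (auto simp: polygon_identity pl_loops_iff extensional_def simp del: atLeastAtMost_iff)
  moreover have "(\<lambda>s\<in>{0..1}. \<gamma> (polygon k t s)) = polygon k (\<gamma> \<circ> t)"
  proof
    fix s show "(\<lambda>s\<in>{0..1}. \<gamma> (polygon k t s)) s = polygon k (\<gamma> \<circ> t) s"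
      using polygon_substitution[of k s t \<gamma>] \<open>0 < k\<close> t polygon_extensional[of k "\<gamma> \<circ> t"]
      by (cases "s \<in> {0..1}") (auto simp: extensional_def)
  qed
  ultimately show "homotopic_with_canon (\<lambda>h. h \<in> pl_loops C x0) {0..1} (path_image \<gamma>) \<gamma> (polygon k (\<gamma> \<circ> t))"
    using homotopic_reparametrisations[OF \<gamma> \<open>0 < k\<close>, of "\<lambda>i. real i / real k" t] assms(2-4) t01 \<gamma>
    by (simp add: pl_loops_iff divide_le_eq)
qed

lemma tuples_fun_upd:
  assumes "x \<in> tuples C x0 k" "0 < i" "i < k" "S \<in> C" "x (i - 1) \<in> S" "y \<in> S" "x (i + 1) \<in> S"
  shows "x(i := y) \<in> tuples C x0 k"
proof -
  have "\<exists>S\<in>C. (x(i := y)) j \<in> S \<and> (x(i := y)) (Suc j) \<in> S" if "j < k" for j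
  proof -
    consider "Suc j = i" | "j = i" | "j \<noteq> i" "Suc j \<noteq> i"
      by blast
    then show ?thesis
    proof cases
      case 3
      then show ?thesis using assms(1) that by (auto simp: tuples_def)
    next
      case 1
      then show ?thesis using assms(4-7) by (intro bexI[of _ S]) auto
    next
      case 2
      then show ?thesis using assms(4-7) by (intro bexI[of _ S]) auto
    qed
  qed
  moreover have "x(i := y) \<in> {..k} \<rightarrow>\<^sub>E \<Union>C"
    using assms by (intro PiE_I) (auto simp: tuples_def PiE_iff extensional_def simp del: Union_iff)
  ultimately show ?thesis
    using assms by (auto simp: tuples_def)
qed

text \<open>The two segments cover the convex hull of the three aligned points. This keeps the polygon inside
  its original image while a vertex slides along an edge.\<close>

lemma collinear_segments:
  fixes a b c :: 'a
  assumes "collinear {a, b, c}" "y \<in> closed_segment a b" "z \<in> closed_segment y c"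
  shows "z \<in> closed_segment a b \<union> closed_segment b c"
proof -
  have *: "z \<in> T" if "convex T" "y \<in> T" "c \<in> T" for T
    using assms(3) that closed_segment_subset[of y T c] by blast
  consider "a \<in> closed_segment b c" | "b \<in> closed_segment c a" | "c \<in> closed_segment a b"
    using assms(1) unfolding collinear_between_cases by (auto simp: between_mem_segment)
  then show ?thesis
  proof cases
    case 1
    then have "closed_segment a b \<subseteq> closed_segment b c"
      by (intro closed_segment_subset) auto
    then show ?thesis
      using *[of "closed_segment b c"] assms(2) by auto
  next
    case 2
    then have b: "b \<in> closed_segment a c"
      by (simp add: closed_segment_commute)
    then have "closed_segment a b \<subseteq> closed_segment a c"
      by (intro closed_segment_subset) auto
    then show ?thesis
      using *[of "closed_segment a c"] assms(2) Un_closed_segment[OF b] by auto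
  next
    case 3
    then show ?thesis
      using *[of "closed_segment a b"] assms(2) by auto
  qed
qed

lemma polygon_piece_covers_segment:
  assumes "i < k"
  shows "closed_segment (x i) (x (Suc i)) \<subseteq> path_image (polygon k x)"
proof
  fix z assume "z \<in> closed_segment (x i) (x (Suc i))"
  then obtain u where u: "u \<in> {0..1}" "z = (1 - u) *\<^sub>R x i + u *\<^sub>R x (Suc i)"
    by (auto simp: in_segment)
  moreover have "(real i + u) / real k \<in> {0..1}"
    using u assms by (auto simp: divide_le_eq)
  ultimately show "z \<in> path_image (polygon k x)"
    using polygon_piece[OF assms u(1), of x] unfolding path_image_def by (metis image_eqI)
qed

text \<open>Move the aligned vertex along its edge back to the preceding vertex.\<close>

lemma thin_homotopic_slide:
  assumes x: "x \<in> tuples C x0 k" and i: "0 < i" "i < k"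
    and S: "S \<in> C" "x (i - 1) \<in> S" "x i \<in> S" "x (i + 1) \<in> S"
    and col: "collinear {x (i - 1), x i, x (i + 1)}"
  shows "thin_homotopic C x0 (polygon k x) (polygon k (x(i := x (i - 1))))"
proof -
  let ?y = "\<lambda>s. (1 - s) *\<^sub>R x i + s *\<^sub>R x (i - 1)"
  let ?H = "\<lambda>s. polygon k (x(i := ?y s))"
  have y: "?y s \<in> closed_segment (x (i - 1)) (x i)" if "s \<in> {0..1}" for s
    using that by (subst closed_segment_commute) (auto simp: in_segment)
  have yS: "?y s \<in> S" if "s \<in> {0..1}" for s
    using convexD_alt[OF convex_cell, of S "x i" "x (i - 1)" s] S that by auto
  have 3: "?H s \<in> pl_loops C x0" if "s \<in> {0..1}" for s
    using yS[OF that] x i S by (intro polygon_in_pl_loops tuples_fun_upd)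
  have comb: "x(i := ?y s) = (\<lambda>j. (1 - s) *\<^sub>R x j + s *\<^sub>R (x(i := x (i - 1))) j)" for s
    by (auto simp: fun_eq_iff algebra_simps)
  have "continuous_on ({0..1} \<times> {0..1}) (\<lambda>z. (1 - fst z) *\<^sub>R polygon k x (snd z) +
      fst z *\<^sub>R polygon k (x(i := x (i - 1))) (snd z))"
    by (intro continuous_intros continuous_on_compose2[OF polygon_continuous]) auto
  then have 1: "continuous_on ({0..1} \<times> {0..1}) (\<lambda>(s, t). ?H s t)"
    by (rule continuous_on_eq) (simp only: case_prod_unfold comb polygon_combination mem_Times_iff)
  have 2: "?H s t \<in> path_image (polygon k x)" if st: "s \<in> {0..1}" "t \<in> {0..1}" for s t
  proof -
    obtain j u where j: "j < k" "u \<in> {0..1}" "t = (real j + u) / real k"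
      using unit_interval_piece[of k t] i st by auto
    let ?z = "(1 - u) *\<^sub>R (x(i := ?y s)) j + u *\<^sub>R (x(i := ?y s)) (Suc j)"
    have seg: "(1 - u) *\<^sub>R a + u *\<^sub>R b \<in> closed_segment a b" for a b :: 'a
      using j(2) by (auto simp: in_segment)
    have cover: "closed_segment (x l) (x (Suc l)) \<subseteq> path_image (polygon k x)" if "l < k" for l
      using polygon_piece_covers_segment that .
    have "closed_segment (x (i - 1)) (x i) \<subseteq> path_image (polygon k x)"
      "closed_segment (x i) (x (i + 1)) \<subseteq> path_image (polygon k x)"
      using cover[of "i - 1"] cover[of i] i by simp_all
    moreover have "?z \<in> closed_segment (x (i - 1)) (x i)" if "Suc j = i"
    proof -
      have "closed_segment (x (i - 1)) (?y s) \<subseteq> closed_segment (x (i - 1)) (x i)"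
        using y[OF st(1)] by (intro closed_segment_subset) auto
      then show ?thesis
        using seg[of "x (i - 1)" "?y s"] that by auto
    qed
    moreover have "?z \<in> closed_segment (x (i - 1)) (x i) \<union> closed_segment (x i) (x (i + 1))" if "j = i"
      using collinear_segments[OF col y[OF st(1)]] seg[of "?y s" "x (i + 1)"] that by simp
    moreover have "?z \<in> closed_segment (x j) (x (Suc j))" if "j \<noteq> i" "Suc j \<noteq> i"
      using seg[of "x j" "x (Suc j)"] that by simp
    ultimately have "?z \<in> path_image (polygon k x)"
      using cover[OF j(1)] by blast
    then show ?thesis
      using polygon_piece[OF j(1,2)] j(3) by metis
  qed
  have "homotopic_with_canon (\<lambda>h. h \<in> pl_loops C x0) {0..1} (path_image (polygon k x))
      (polygon k x) (polygon k (x(i := x (i - 1))))"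
    by (rule homotopic_pl_loopsI[of ?H, OF 1 2 3]) simp_all
  then show ?thesis
    by (rule homotopic_imp_thin_homotopic)
qed

lemma delete_entry_apply:
  "j \<le> k - 1 \<Longrightarrow> delete_entry k i x j = (if j < i then x j else x (Suc j))"
  by (simp add: delete_entry_def)

lemma delete_entry_in_tuples:
  assumes "x \<in> tuples C x0 k" "0 < i" "i < k" "S \<in> C" "x (i - 1) \<in> S" "x (i + 1) \<in> S"
  shows "delete_entry k i x \<in> tuples C x0 (k - 1)"
proof -
  have x: "x 0 = x0" "x k = x0" "\<And>j. j \<le> k \<Longrightarrow> x j \<in> \<Union>C"
    "\<And>j. j < k \<Longrightarrow> \<exists>S\<in>C. x j \<in> S \<and> x (Suc j) \<in> S"
    using assms(1) by (auto simp: tuples_def PiE_def Pi_def)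
  have "\<exists>S\<in>C. delete_entry k i x j \<in> S \<and> delete_entry k i x (Suc j) \<in> S" if "j < k - 1" for j
  proof -
    consider "Suc j < i" | "Suc j = i" | "i \<le> j" by linarith
    then show ?thesis
    proof cases
      case 1
      then show ?thesis using x(4)[of j] that by (simp add: delete_entry_apply)
    next
      case 2
      then have "x j \<in> S" "x (Suc (Suc j)) \<in> S" using assms by auto
      then show ?thesis using \<open>S \<in> C\<close> 2 that by (auto simp: delete_entry_apply)
    next
      case 3
      then show ?thesis using x(4)[of "Suc j"] that by (simp add: delete_entry_apply)
    qed
  qed
  moreover have "delete_entry k i x j \<in> \<Union>C" if "j \<le> k - 1" for j
    using x(3)[of j] x(3)[of "Suc j"] that assms(2,3) by (simp add: delete_entry_apply del: Union_iff)
  moreover have "delete_entry k i x 0 = x0" "delete_entry k i x (k - 1) = x0"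
    using x(1,2) assms(2,3) by (simp_all add: delete_entry_apply)
  moreover have "delete_entry k i x \<in> extensional {..k - 1}"
    by (simp add: delete_entry_def)
  ultimately show ?thesis
    by (simp add: tuples_def PiE_iff del: Union_iff)
qed

text \<open>A polygon that pauses at a vertex is a reparametrisation of the polygon with one vertex less.\<close>

lemma thin_homotopic_collapse:
  assumes x: "x \<in> tuples C x0 k" and i: "0 < i" "i < k"
    and S: "S \<in> C" "x (i - 1) \<in> S" "x (i + 1) \<in> S"
  shows "thin_homotopic C x0 (polygon (k - 1) (delete_entry k i x)) (polygon k (x(i := x (i - 1))))"
proof -
  let ?y = "delete_entry k i x"
  \<comment> \<open>The reparametrisation stands still on the piece from \<open>i - 1\<close> to \<open>i\<close>.\<close>
  define \<delta> where "\<delta> j = (if j < i then j else j - 1)" for j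
  define t where "t j = real (\<delta> j) / real (k - 1)" for j
  have k: "0 < k - 1" "0 < k"
    using i by auto
  have "thin_homotopic C x0 (polygon (k - 1) ?y) (polygon k (polygon (k - 1) ?y \<circ> t))"
  proof (rule thin_homotopic_polygon)
    show "polygon (k - 1) ?y \<in> pl_loops C x0"
      using delete_entry_in_tuples[OF x i S] by (rule polygon_in_pl_loops)
    show "t 0 = 0" "t k = 1"
      using i by (auto simp: t_def \<delta>_def)
    show "t j \<le> t (Suc j) \<and> affine_on_interval (t j) (t (Suc j)) (polygon (k - 1) ?y)" if "j < k" for j
    proof (cases "Suc j = i")
      case True
      then have "t (Suc j) = t j"
        by (simp add: t_def \<delta>_def)
      then show ?thesis
        by (simp add: affine_on_interval_iff algebra_simps flip: scaleR_add_left)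
    next
      case False
      then have "\<delta> (Suc j) = Suc (\<delta> j)" "\<delta> j < k - 1"
        using that i by (auto simp: \<delta>_def)
      then show ?thesis
        using polygon_affine_piece[of "\<delta> j" "k - 1" ?y] by (simp add: t_def divide_right_mono)
    qed
  qed (use k in auto)
  moreover have "polygon k (polygon (k - 1) ?y \<circ> t) = polygon k (x(i := x (i - 1)))"
  proof (rule polygon_cong)
    fix j assume "j \<le> k"
    then have "\<delta> j \<le> k - 1"
      using i by (auto simp: \<delta>_def)
    then have "(polygon (k - 1) ?y \<circ> t) j = ?y (\<delta> j)"
      using polygon_vertex[of "k - 1" "\<delta> j" ?y] k by (simp add: t_def)
    also have "\<dots> = (x(i := x (i - 1))) j"
      using i \<open>\<delta> j \<le> k - 1\<close> by (auto simp: delete_entry_def \<delta>_def)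
    finally show "(polygon (k - 1) ?y \<circ> t) j = (x(i := x (i - 1))) j" .
  qed
  ultimately show ?thesis by simp
qed

lemma tuple_step_in_tuples:
  assumes "tuple_step C x0 (k, x) (l, y)"
  shows "x \<in> tuples C x0 k \<and> y \<in> tuples C x0 l"
  using assms
proof cases
  case (delete i S)
  then show ?thesis using delete_entry_in_tuples by blast
next
  case trivial
  then show ?thesis
    using base_point by (auto simp: tuples_def less_Suc_eq)
qed

lemma tuple_step_thin_homotopic:
  assumes "tuple_step C x0 (k, x) (l, y)"
  shows "thin_homotopic C x0 (polygon k x) (polygon l y)"
  using assms
proof cases
  case (delete i S)
  then have "thin_homotopic C x0 (polygon k x) (polygon k (x(i := x (i - 1))))"
    by (intro thin_homotopic_slide) auto
  also have "thin_homotopic C x0 \<dots> (polygon l y)"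
    using delete thin_homotopic_sym[OF thin_homotopic_collapse] by auto
  finally show ?thesis .
next
  case trivial
  then have "polygon k x = polygon l y"
    by (auto simp: polygon_def hat_def fun_eq_iff restrict_def simp flip: scaleR_add_left)
  then show ?thesis
    using tuple_step_in_tuples[OF assms] polygon_in_pl_loops thin_homotopic_refl by metis
qed

lemma tuple_rel_thin_homotopic:
  assumes "((k, x), (l, y)) \<in> tuple_rel C x0" "x \<in> tuples C x0 k"
  shows "y \<in> tuples C x0 l" "thin_homotopic C x0 (polygon k x) (polygon l y)"
proof -
  have "snd q \<in> tuples C x0 (fst q) \<and> thin_homotopic C x0 (polygon k x) (polygon (fst q) (snd q))"
    if "equivclp (tuple_step C x0) (k, x) q" for q
    using that
  proof (induction rule: equivclp_induct)
    case base
    then show ?case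
      using assms(2) polygon_in_pl_loops thin_homotopic_refl by simp
  next
    case (step p q)
    then have "snd q \<in> tuples C x0 (fst q) \<and>
        thin_homotopic C x0 (polygon (fst p) (snd p)) (polygon (fst q) (snd q))"
      using tuple_step_in_tuples tuple_step_thin_homotopic thin_homotopic_sym
      by (metis prod.collapse)
    then show ?case
      using step.IH thin_homotopic_trans by blast
  qed
  from this[of "(l, y)"] show "y \<in> tuples C x0 l" "thin_homotopic C x0 (polygon k x) (polygon l y)"
    using assms(1) by (auto simp: tuple_rel_def)
qed

section \<open>Reading off vertices\<close>

definition vertex_tuple :: "(real \<Rightarrow> 'a) \<Rightarrow> nat \<times> (nat \<Rightarrow> 'a)" where
  "vertex_tuple \<gamma> = tuple_of_list (SOME zs. traverses C \<gamma> 0 1 zs)"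

lemma tuple_rel_refl: "(p, p) \<in> tuple_rel C x0"
  by (simp add: tuple_rel_def)

lemma tuple_rel_sym: "(p, q) \<in> tuple_rel C x0 \<Longrightarrow> (q, p) \<in> tuple_rel C x0"
  by (auto simp: tuple_rel_def intro: equivclp_sym)

lemma tuple_rel_trans: "(p, q) \<in> tuple_rel C x0 \<Longrightarrow> (q, r) \<in> tuple_rel C x0 \<Longrightarrow> (p, r) \<in> tuple_rel C x0"
  unfolding tuple_rel_def by (auto intro: equivp_transp[OF equivp_evquivclp])

lemma tuple_class_eq: "(p, q) \<in> tuple_rel C x0 \<Longrightarrow> tuple_rel C x0 `` {p} = tuple_rel C x0 `` {q}"
  using tuple_rel_sym tuple_rel_trans by blast

lemma traverses_loop_list:
  assumes "\<gamma> \<in> pl_loops C x0" "traverses C \<gamma> 0 1 zs"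
  shows "loop_list C x0 zs"
  using assms traverses_chain traverses_ends unfolding loop_list_def pl_loops_iff by metis

lemma vertex_tuple_eqv:
  assumes "\<gamma> \<in> pl_loops C x0" "traverses C \<gamma> 0 1 zs" "list_eqv C zs ws"
  shows "(vertex_tuple \<gamma>, tuple_of_list ws) \<in> tuple_rel C x0"
proof -
  let ?ys = "SOME zs. traverses C \<gamma> 0 1 zs"
  have ys: "traverses C \<gamma> 0 1 ?ys"
    using assms(2) by (rule someI)
  then have "list_eqv C ?ys ws"
    using traverses_unique assms list_eqv_trans by blast
  then show ?thesis
    unfolding vertex_tuple_def using traverses_loop_list[OF assms(1) ys] by (rule list_eqv_tuple_rel)
qed

lemma vertex_tuple_respects:
  assumes "thin_homotopic C x0 f g"
  shows "(vertex_tuple f, vertex_tuple g) \<in> tuple_rel C x0"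
proof -
  obtain zf zg where z: "traverses C f 0 1 zf" "traverses C g 0 1 zg"
    using thin_homotopic_in_pl_loops[OF assms] pl_loops_traverses by metis
  have "(vertex_tuple f, tuple_of_list zg) \<in> tuple_rel C x0"
    using z thin_homotopic_in_pl_loops[OF assms] thin_homotopic_imp_list_eqv[OF assms]
    by (intro vertex_tuple_eqv)
  moreover have "(vertex_tuple g, tuple_of_list zg) \<in> tuple_rel C x0"
    using z thin_homotopic_in_pl_loops[OF assms] by (intro vertex_tuple_eqv) auto
  ultimately show ?thesis
    using tuple_rel_sym tuple_rel_trans by blast
qed

lemma tuple_of_list_map:
  "tuple_of_list (map x [0..<Suc k]) = (k, \<lambda>j\<in>{..k}. x j)"
  by (auto simp: tuple_of_list_def restrict_def fun_eq_iff less_Suc_eq_le simp del: upt_Suc)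

lemma vertex_tuple_subdivision:
  assumes "\<gamma> \<in> pl_loops C x0" "0 < k" "t 0 = 0" "t k = 1"
    and "\<And>i. i < k \<Longrightarrow> t i \<le> t (Suc i) \<and> affine_on_interval (t i) (t (Suc i)) \<gamma> \<and>
      (\<exists>S\<in>C. \<gamma> ` {t i..t (Suc i)} \<subseteq> S)"
  shows "(vertex_tuple \<gamma>, (k, \<lambda>j\<in>{..k}. \<gamma> (t j))) \<in> tuple_rel C x0"
proof -
  obtain zs where "traverses C \<gamma> 0 1 zs" "list_eqv C zs (map (\<gamma> \<circ> t) [0..<Suc k])"
    using subdivision_traverses[of k t \<gamma> C] assms by auto
  then show ?thesis
    using vertex_tuple_eqv[OF assms(1)] tuple_of_list_map[of "\<gamma> \<circ> t" k] unfolding comp_apply by metis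
qed

lemma vertex_tuple_polygon:
  assumes x: "x \<in> tuples C x0 k"
  shows "(vertex_tuple (polygon k x), (k, x)) \<in> tuple_rel C x0"
proof -
  have ends: "x 0 = x0" and adj: "\<And>i. i < k \<Longrightarrow> \<exists>S\<in>C. x i \<in> S \<and> x (Suc i) \<in> S"
    and ext: "(\<lambda>j\<in>{..k}. x j) = x"
    using x by (auto simp: tuples_def PiE_def extensional_restrict)
  have "\<exists>zs. traverses C (polygon k x) 0 1 zs \<and> list_eqv C zs (map x [0..<Suc k])"
  proof (cases "k = 0")
    case True
    then show ?thesis
      using constant_loop_traverses list_eqv_repeated ends by (auto simp: polygon_0)
  next
    case False
    then show ?thesis
      using polygon_traverses[of k C x] adj convex_cell by blast
  qed
  then show ?thesis
    using vertex_tuple_eqv[OF polygon_in_pl_loops[OF x]] tuple_of_list_map[of x k] ext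
    by (metis (no_types))
qed

lemma pl_loop_subdivision:
  assumes "\<gamma> \<in> pl_loops C x0"
  obtains k t where "0 < k" "t 0 = (0::real)" "t k = 1"
    "\<And>i. i < k \<Longrightarrow> t i \<le> t (Suc i) \<and> affine_on_interval (t i) (t (Suc i)) \<gamma> \<and>
      (\<exists>S\<in>C. \<gamma> ` {t i..t (Suc i)} \<subseteq> S)"
proof -
  obtain zs where "traverses C \<gamma> 0 1 zs"
    using assms by (rule pl_loops_traverses)
  then obtain k t where *: "t 0 = 0" "t k = 1" "\<And>i. i < k \<Longrightarrow> t i < t (Suc i) \<and>
      affine_on_interval (t i) (t (Suc i)) \<gamma> \<and> (\<exists>S\<in>C. \<gamma> ` {t i..t (Suc i)} \<subseteq> S)"
    using traverses_subdivision by metis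
  then have "0 < k"
    by (cases k) auto
  with * that show ?thesis
    by (meson less_imp_le)
qed

lemma vertex_tuple_in_tuples:
  assumes "\<gamma> \<in> pl_loops C x0"
  shows "snd (vertex_tuple \<gamma>) \<in> tuples C x0 (fst (vertex_tuple \<gamma>))"
proof -
  obtain zs where "traverses C \<gamma> 0 1 zs"
    using assms by (rule pl_loops_traverses)
  then have "traverses C \<gamma> 0 1 (SOME zs. traverses C \<gamma> 0 1 zs)"
    by (rule someI)
  then have "loop_list C x0 (SOME zs. traverses C \<gamma> 0 1 zs)"
    using traverses_loop_list assms by blast
  then show ?thesis
    using tuple_of_list_in_tuples by (simp add: vertex_tuple_def tuple_of_list_def)
qed

lemma polygon_vertex_tuple:
  assumes "\<gamma> \<in> pl_loops C x0"
  shows "thin_homotopic C x0 (case_prod polygon (vertex_tuple \<gamma>)) \<gamma>"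
proof -
  obtain k t where kt: "0 < k" "t 0 = (0::real)" "t k = 1"
    "\<And>i. i < k \<Longrightarrow> t i \<le> t (Suc i) \<and> affine_on_interval (t i) (t (Suc i)) \<gamma> \<and>
      (\<exists>S\<in>C. \<gamma> ` {t i..t (Suc i)} \<subseteq> S)"
    using pl_loop_subdivision[OF assms] by metis
  have "(vertex_tuple \<gamma>, (k, \<lambda>j\<in>{..k}. \<gamma> (t j))) \<in> tuple_rel C x0"
    using kt by (intro vertex_tuple_subdivision assms)
  then have "thin_homotopic C x0 (case_prod polygon (vertex_tuple \<gamma>)) (polygon k (\<lambda>j\<in>{..k}. \<gamma> (t j)))"
    using tuple_rel_thin_homotopic(2)[OF _ vertex_tuple_in_tuples[OF assms]] by (simp add: case_prod_unfold)
  also have "polygon k (\<lambda>j\<in>{..k}. \<gamma> (t j)) = polygon k (\<gamma> \<circ> t)"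
    by (rule polygon_cong) simp
  also have "thin_homotopic C x0 \<dots> \<gamma>"
    using kt by (intro thin_homotopic_sym[OF thin_homotopic_polygon] assms) auto
  finally show ?thesis .
qed

section \<open>Continuity of the polygon map\<close>

abbreviation loop_metric :: "(real \<Rightarrow> 'a) metric" where
  "loop_metric \<equiv> cfunspace (top_of_set {0..1}) euclidean_metric"

lemma pl_loops_filt_subset_mspace: "pl_loops_filt C x0 n \<subseteq> mspace loop_metric"
proof -
  have "topspace (pl_filt_topology C x0 n) \<subseteq> topspace (mtopology_of loop_metric)"
    unfolding pl_filt_topology_def by simp
  then show ?thesis by simp
qed

text \<open>The constant loop that belongs to \<open>k = 0\<close> still needs one piece to cover \<open>[0, 1]\<close>.\<close>

lemma polygon_in_filt:
  assumes x: "x \<in> tuples C x0 k"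
  shows "polygon k x \<in> pl_loops_filt C x0 (max 1 k)"
proof -
  have *: "polygon l y \<in> pl_loops_filt C x0 (max 1 k)" if y: "y \<in> tuples C x0 l" and l: "0 < l" "l \<le> max 1 k" for l y
  proof -
    have "real i / real l \<le> real (Suc i) / real l \<and>
        affine_on_interval (real i / real l) (real (Suc i) / real l) (polygon l y) \<and>
        (\<exists>S\<in>C. polygon l y ` {real i / real l..real (Suc i) / real l} \<subseteq> S)" if "i < l" for i
    proof -
      have "\<exists>S\<in>C. y i \<in> S \<and> y (Suc i) \<in> S"
        using y that by (auto simp: tuples_def)
      then show ?thesis
        using polygon_affine_piece[OF that] polygon_piece_image[OF that, of _ y] convex_cell
        by (meson divide_right_mono of_nat_0_le_iff of_nat_le_iff lessI less_imp_le)
    qed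
    then show ?thesis
      using polygon_in_pl_loops[OF y] l unfolding pl_loops_filt_def
      by (intro CollectI conjI exI[of _ l] exI[of _ "\<lambda>i. real i / real l"]) auto
  qed
  show ?thesis
  proof (cases "k = 0")
    case True
    have "polygon 0 x = polygon 1 (\<lambda>j\<in>{..1}. x0)"
      using x True by (auto simp: tuples_def polygon_def hat_def fun_eq_iff restrict_def simp flip: scaleR_add_left)
    moreover have "(\<lambda>j\<in>{..1}. x0) \<in> tuples C x0 1"
      using tuple_step_in_tuples[OF tuple_step.trivial] by simp
    ultimately show ?thesis
      using *[of "\<lambda>j\<in>{..1}. x0" 1] True by simp
  next
    case False
    then show ?thesis using *[OF x] by simp
  qed
qed

text \<open>The sup distance of two polygons is at most the sum of the distances of their vertices.\<close>

lemma continuous_map_polygon: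
  "continuous_map (tuple_space C x0 k) (pl_filt_topology C x0 (max 1 k)) (polygon k)"
proof -
  interpret M: Metric_space "mspace loop_metric" "mdist loop_metric"
    by (rule Metric_space_mspace_mdist)
  have polygon_mspace: "polygon k x \<in> mspace loop_metric" if "x \<in> tuples C x0 k" for x
    using polygon_in_filt[OF that] pl_loops_filt_subset_mspace by blast
  have coordinate: "continuous_map (tuple_space C x0 k) euclidean (\<lambda>y. y i)" if "i \<le> k" for i
    using continuous_map_product_coordinates[of i "{..k}" "\<lambda>_. top_of_set (\<Union>C)"] that
    unfolding tuple_space_def
    by (intro continuous_map_from_subtopology) (auto simp: continuous_map_in_subtopology)
  have "continuous_map (tuple_space C x0 k) M.mtopology (polygon k)"
    unfolding M.continuous_map_to_metric
  proof (intro ballI allI impI)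
    fix x and \<epsilon> :: real
    assume x: "x \<in> topspace (tuple_space C x0 k)" and "\<epsilon> > 0"
    define g where "g y = (\<Sum>i\<le>k. dist (x i) (y i))" for y
    have "continuous_map (tuple_space C x0 k) euclidean g"
      unfolding g_def
    proof (intro continuous_map_sum)
      fix i assume "i \<in> {..k}"
      then have "continuous_map (tuple_space C x0 k) euclidean ((\<lambda>z. dist (x i) z) \<circ> (\<lambda>y. y i))"
        using coordinate by (intro continuous_map_compose[of _ euclidean]) (auto intro!: continuous_intros)
      then show "continuous_map (tuple_space C x0 k) euclidean (\<lambda>y. dist (x i) (y i))"
        by (simp add: comp_def)
    qed simp
    then have "openin (tuple_space C x0 k) {y \<in> topspace (tuple_space C x0 k). g y \<in> {..<\<epsilon>}}"
      by (rule openin_continuous_map_preimage) auto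
    moreover have "polygon k y \<in> M.mball (polygon k x) \<epsilon>" if y: "y \<in> topspace (tuple_space C x0 k)" "g y < \<epsilon>" for y
    proof -
      have "mdist loop_metric (polygon k x) (polygon k y) \<le> g y"
        using polygon_dist[of _ k x y] by (intro mdist_cfunspace_le) (auto simp: g_def sum_nonneg)
      then show ?thesis
        using y x polygon_mspace unfolding M.in_mball by (simp del: mspace_cfunspace)
    qed
    ultimately show "\<exists>U. openin (tuple_space C x0 k) U \<and> x \<in> U \<and>
        (\<forall>y\<in>U. polygon k y \<in> M.mball (polygon k x) \<epsilon>)"
      using x \<open>\<epsilon> > 0\<close> by (intro exI[of _ "{y \<in> topspace (tuple_space C x0 k). g y \<in> {..<\<epsilon>}}"]) (auto simp: g_def)
  qed
  then show ?thesis
    unfolding pl_filt_topology_def mtopology_of_def using polygon_in_filt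
    by (auto simp: continuous_map_in_subtopology)
qed

section \<open>Continuity of reading off vertices\<close>

text \<open>Degenerate pieces at the end bring the number of pieces to exactly \<open>n\<close>, so that all vertex tuples
  that occur can be compared in one space of tuples.\<close>

lemma pl_loops_filt_padded_subdivision:
  assumes "\<gamma> \<in> pl_loops_filt C x0 n"
  obtains t where "0 < n" "t 0 = (0::real)" "t n = 1" "\<And>i. t i \<in> {0..1}"
    "\<And>i. i < n \<Longrightarrow> t i \<le> t (Suc i) \<and> affine_on_interval (t i) (t (Suc i)) \<gamma> \<and>
      (\<exists>S\<in>C. \<gamma> ` {t i..t (Suc i)} \<subseteq> S)"
proof -
  obtain k s where \<gamma>: "\<gamma> \<in> pl_loops C x0" and k: "k \<le> n" "s 0 = 0" "s k = 1"
    and s: "\<And>i. i < k \<Longrightarrow> s i \<le> s (Suc i) \<and> affine_on_interval (s i) (s (Suc i)) \<gamma> \<and>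
           (\<exists>S\<in>C. \<gamma> ` {s i..s (Suc i)} \<subseteq> S)"
    using assms by (auto simp: pl_loops_filt_def)
  have "0 < k"
    using k by (cases k) auto
  have mono: "s i \<le> s j" if "i \<le> j" "j \<le> k" for i j
    using that s by (induction j rule: dec_induct) (auto intro: order_trans)
  define t where "t i = (if i \<le> k then s i else 1)" for i
  show ?thesis
  proof (rule that[of t])
    show "t i \<in> {0..1}" for i
      using mono[of 0 i] mono[of i k] k by (auto simp: t_def)
    show "t i \<le> t (Suc i) \<and> affine_on_interval (t i) (t (Suc i)) \<gamma> \<and>
      (\<exists>S\<in>C. \<gamma> ` {t i..t (Suc i)} \<subseteq> S)" if "i < n" for i
    proof (cases "i < k")
      case True
      then show ?thesis using s by (simp add: t_def)
    next
      case False
      then have "t i = 1" "t (Suc i) = 1"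
        using k by (auto simp: t_def)
      moreover have "affine_on_interval 1 1 \<gamma>"
        by (simp add: affine_on_interval_iff algebra_simps flip: scaleR_add_left)
      moreover have "\<exists>S\<in>C. \<gamma> ` {1..1} \<subseteq> S"
        using base_point \<gamma> by (auto simp: pl_loops_iff)
      ultimately show ?thesis by simp
    qed
  qed (use k \<open>0 < k\<close> in \<open>auto simp: t_def\<close>)
qed

text \<open>If loops \<open>\<sigma>\<^sub>m\<close> outside the preimage converge to \<open>\<gamma>\<close> in the preimage, then a subsequence of their
  subdivisions converges to a subdivision of \<open>\<gamma>\<close>, and the corresponding vertex tuples converge. Since the
  class of the limit tuple lies in \<open>V\<close>, so do the classes of tuples close to it, a contradiction.\<close>

lemma openin_vertex_tuple_preimage:
  assumes V: "openin (tuple_space C x0 n) {x \<in> tuples C x0 n. tuple_rel C x0 `` {(n, x)} \<in> V}"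
  shows "openin (pl_filt_topology C x0 n)
    {\<gamma> \<in> pl_loops_filt C x0 n. tuple_rel C x0 `` {vertex_tuple \<gamma>} \<in> V}"
proof -
  let ?F = "pl_loops_filt C x0 n"
  let ?W = "{x \<in> tuples C x0 n. tuple_rel C x0 `` {(n, x)} \<in> V}"
  define A where "A = {\<gamma> \<in> ?F. tuple_rel C x0 `` {vertex_tuple \<gamma>} \<in> V}"
  let ?m = "submetric loop_metric ?F"
  interpret M: Metric_space "mspace ?m" "mdist ?m"
    by (rule Metric_space_mspace_mdist)
  have mspace: "mspace ?m = ?F"
    using pl_loops_filt_subset_mspace by auto
  have loop: "\<gamma> \<in> pl_loops C x0" if "\<gamma> \<in> ?F" for \<gamma>
    using that by (simp add: pl_loops_filt_def)
  have "openin M.mtopology A"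
    unfolding M.openin_mtopology
  proof (intro conjI allI impI)
    show "A \<subseteq> mspace ?m"
      unfolding mspace by (auto simp: A_def)
  next
    fix \<gamma> assume \<gamma>: "\<gamma> \<in> A"
    show "\<exists>r>0. M.mball \<gamma> r \<subseteq> A"
    proof (rule ccontr)
      assume "\<not> (\<exists>r>0. M.mball \<gamma> r \<subseteq> A)"
      then have "\<exists>\<sigma>. \<sigma> \<in> M.mball \<gamma> (1 / real (Suc m)) \<and> \<sigma> \<notin> A" for m
        by (metis subsetI of_nat_0_less_iff zero_less_Suc zero_less_divide_1_iff)
      then obtain \<sigma> where \<sigma>: "\<And>m. \<sigma> m \<in> M.mball \<gamma> (1 / real (Suc m))" "\<And>m. \<sigma> m \<notin> A"
        by metis
      have \<gamma>F: "\<gamma> \<in> ?F" and \<sigma>F: "\<sigma> m \<in> ?F" for m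
        using \<gamma> \<sigma>(1)[of m] M.in_mball mspace unfolding A_def by blast+
      have \<sigma>_close: "dist (\<gamma> x) (\<sigma> m x) \<le> 1 / real (Suc m)" if "x \<in> {0..1}" for m x
      proof -
        have "mdist loop_metric \<gamma> (\<sigma> m) \<le> 1 / real (Suc m)"
          using \<sigma>(1)[of m] unfolding M.in_mball by (simp del: mspace_cfunspace)
        then have "mdist euclidean_metric (\<gamma> x) (\<sigma> m x) \<le> 1 / real (Suc m)"
          using pl_loops_filt_subset_mspace \<gamma>F \<sigma>F that
          by (intro mdist_cfunspace_imp_mdist_le[of \<gamma> "top_of_set {0..1}" euclidean_metric "\<sigma> m"]) auto
        then show ?thesis by simp
      qed
      have "\<exists>t. t 0 = (0::real) \<and> t n = 1 \<and> (\<forall>i. t i \<in> {0..1}) \<and> (\<forall>i<n. t i \<le> t (Suc i) \<and>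
          affine_on_interval (t i) (t (Suc i)) (\<sigma> m) \<and> (\<exists>S\<in>C. \<sigma> m ` {t i..t (Suc i)} \<subseteq> S))" for m
        by (rule pl_loops_filt_padded_subdivision[OF \<sigma>F[of m]]) blast
      then obtain \<tau> where \<tau>0: "\<And>m. \<tau> m 0 = (0::real)" and \<tau>n: "\<And>m. \<tau> m n = 1"
        and \<tau>01: "\<And>m i. \<tau> m i \<in> {0..1}"
        and \<tau>: "\<And>m i. i < n \<Longrightarrow> \<tau> m i \<le> \<tau> m (Suc i) \<and>
          affine_on_interval (\<tau> m i) (\<tau> m (Suc i)) (\<sigma> m) \<and> (\<exists>S\<in>C. \<sigma> m ` {\<tau> m i..\<tau> m (Suc i)} \<subseteq> S)"
        by metis
      have "0 < n"
        using \<tau>0[of 0] \<tau>n[of 0] by (cases n) auto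
      have "compactin (product_topology (\<lambda>_. euclidean) UNIV) (PiE UNIV (\<lambda>_::nat. {0..1::real}))"
        by (simp add: compactin_PiE)
      then have "compact (PiE UNIV (\<lambda>_::nat. {0..1::real}))"
        by (simp add: euclidean_product_topology)
      then have "seq_compact (PiE UNIV (\<lambda>_::nat. {0..1::real}))"
        by (rule compact_imp_seq_compact)
      moreover have "\<forall>m. \<tau> m \<in> PiE UNIV (\<lambda>_. {0..1})"
        using \<tau>01 by auto
      ultimately obtain l r where l: "l \<in> PiE UNIV (\<lambda>_. {0..1})" and r: "strict_mono r"
        and lim: "(\<tau> \<circ> r) \<longlonglongrightarrow> l"
        by (rule seq_compactE)
      have l01: "l i \<in> {0..1}" for i
        using l by auto
      have \<tau>_lim: "(\<lambda>m. \<tau> (r m) i) \<longlonglongrightarrow> l i" for i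
        using continuous_on_tendsto_compose[OF continuous_on_product_coordinates lim] by (simp add: comp_def)
      have cont: "continuous_on {0..1} \<gamma>"
        using pl_loop_path(1)[OF loop[OF \<gamma>F]] by (simp add: path_def)
      \<comment> \<open>Uniform convergence allows the argument to vary with \<open>m\<close>.\<close>
      have value_lim: "(\<lambda>m. \<sigma> (r m) (a m)) \<longlonglongrightarrow> \<gamma> b"
        if ab: "a \<longlonglongrightarrow> b" "\<And>m. a m \<in> {0..1}" "b \<in> {0..1}" for a b
      proof -
        have 1: "(\<lambda>m. \<gamma> (a m)) \<longlonglongrightarrow> \<gamma> b"
          using ab by (intro continuous_on_tendsto_compose[OF cont]) auto
        have "dist (\<sigma> (r m) (a m)) (\<gamma> (a m)) \<le> 1 / real (Suc m)" for m
        proof -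
          have "dist (\<sigma> (r m) (a m)) (\<gamma> (a m)) \<le> 1 / real (Suc (r m))"
            using \<sigma>_close[OF ab(2)] by (simp add: dist_commute)
          also have "\<dots> \<le> 1 / real (Suc m)"
            using seq_suble[OF r, of m] by (simp add: frac_le)
          finally show ?thesis .
        qed
        then have 2: "(\<lambda>m. \<sigma> (r m) (a m) - \<gamma> (a m)) \<longlonglongrightarrow> 0"
          by (intro Lim_null_comparison[OF _ LIMSEQ_Suc[OF lim_1_over_n]]) (auto simp: dist_norm)
        show ?thesis
          using tendsto_add[OF 2 1] by simp
      qed
      have vertex_lim: "(\<lambda>m. \<sigma> (r m) (\<tau> (r m) i)) \<longlonglongrightarrow> \<gamma> (l i)" for i
        using \<tau>_lim \<tau>01 l01 by (intro value_lim) auto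
      have ends: "l 0 = 0" "l n = 1"
        using \<tau>_lim[of 0] \<tau>_lim[of n] \<tau>0 \<tau>n by (simp_all add: LIMSEQ_const_iff)
      have pieces: "l i \<le> l (Suc i) \<and> affine_on_interval (l i) (l (Suc i)) \<gamma> \<and>
          (\<exists>S\<in>C. \<gamma> ` {l i..l (Suc i)} \<subseteq> S)" if i: "i < n" for i
      proof -
        have le: "l i \<le> l (Suc i)"
          using \<tau> i by (intro LIMSEQ_le[OF \<tau>_lim \<tau>_lim]) auto
        have affine: "\<gamma> ((1 - u) * l i + u * l (Suc i)) = (1 - u) *\<^sub>R \<gamma> (l i) + u *\<^sub>R \<gamma> (l (Suc i))"
          if u: "u \<in> {0..1}" for u
        proof -
          have in01: "(1 - u) * c + u * d \<in> {0..1}" if "c \<in> {0..1}" "d \<in> {0..1}" for c d :: real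
            using convexD_alt[of "{0..1::real}" c d u] that u by (simp del: atLeastAtMost_iff) auto
          have "(\<lambda>m. \<sigma> (r m) ((1 - u) * \<tau> (r m) i + u * \<tau> (r m) (Suc i))) \<longlonglongrightarrow>
              \<gamma> ((1 - u) * l i + u * l (Suc i))"
            using in01 \<tau>01 l01 by (intro value_lim tendsto_intros \<tau>_lim) auto
          moreover have "\<sigma> (r m) ((1 - u) * \<tau> (r m) i + u * \<tau> (r m) (Suc i)) =
              (1 - u) *\<^sub>R \<sigma> (r m) (\<tau> (r m) i) + u *\<^sub>R \<sigma> (r m) (\<tau> (r m) (Suc i))" for m
            using \<tau>[OF i, of "r m"] u by (auto simp: affine_on_interval_iff)
          ultimately have "(\<lambda>m. (1 - u) *\<^sub>R \<sigma> (r m) (\<tau> (r m) i) + u *\<^sub>R \<sigma> (r m) (\<tau> (r m) (Suc i))) \<longlonglongrightarrow>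
              \<gamma> ((1 - u) * l i + u * l (Suc i))"
            by simp
          moreover have "(\<lambda>m. (1 - u) *\<^sub>R \<sigma> (r m) (\<tau> (r m) i) + u *\<^sub>R \<sigma> (r m) (\<tau> (r m) (Suc i))) \<longlonglongrightarrow>
              (1 - u) *\<^sub>R \<gamma> (l i) + u *\<^sub>R \<gamma> (l (Suc i))"
            by (intro tendsto_intros vertex_lim)
          ultimately show ?thesis
            by (rule LIMSEQ_unique)
        qed
        \<comment> \<open>Being the ends of an edge in some cell is a closed condition, and by convexity it puts the whole
          limit edge into that cell.\<close>
        have "closed (\<Union>S\<in>C. S \<times> S)"
          using finite_cells closed_cell by (intro closed_UN ballI closed_Times) auto
        moreover have "(\<sigma> (r m) (\<tau> (r m) i), \<sigma> (r m) (\<tau> (r m) (Suc i))) \<in> (\<Union>S\<in>C. S \<times> S)" for m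
        proof -
          obtain S where "S \<in> C" "\<sigma> (r m) ` {\<tau> (r m) i..\<tau> (r m) (Suc i)} \<subseteq> S"
              "\<tau> (r m) i \<le> \<tau> (r m) (Suc i)"
            using \<tau>[OF i, of "r m"] by blast
          then show ?thesis
            by (intro UN_I[of S]) (simp_all add: image_subset_iff)
        qed
        moreover have "(\<lambda>m. (\<sigma> (r m) (\<tau> (r m) i), \<sigma> (r m) (\<tau> (r m) (Suc i)))) \<longlonglongrightarrow> (\<gamma> (l i), \<gamma> (l (Suc i)))"
          by (intro tendsto_intros vertex_lim)
        ultimately have "(\<gamma> (l i), \<gamma> (l (Suc i))) \<in> (\<Union>S\<in>C. S \<times> S)"
          by (rule closed_sequentially)
        then obtain S where S: "S \<in> C" "\<gamma> (l i) \<in> S" "\<gamma> (l (Suc i)) \<in> S"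
          by blast
        have "\<gamma> t \<in> S" if t: "t \<in> {l i..l (Suc i)}" for t
        proof -
          obtain u where "u \<in> {0..1}" "t = (1 - u) * l i + u * l (Suc i)"
            using t by (rule interval_convex_combination)
          then show ?thesis
            using affine convexD_alt[OF convex_cell[OF S(1)] S(2,3)] by auto
        qed
        then have "\<exists>S\<in>C. \<gamma> ` {l i..l (Suc i)} \<subseteq> S"
          using S(1) by blast
        then show ?thesis
          using le affine by (simp add: affine_on_interval_iff)
      qed
      let ?x = "\<lambda>j\<in>{..n}. \<gamma> (l j)"
      let ?y = "\<lambda>m. \<lambda>j\<in>{..n}. \<sigma> (r m) (\<tau> (r m) j)"
      have x: "(vertex_tuple \<gamma>, (n, ?x)) \<in> tuple_rel C x0"
        using ends pieces \<open>0 < n\<close> by (intro vertex_tuple_subdivision loop \<gamma>F)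
      have y: "(vertex_tuple (\<sigma> (r m)), (n, ?y m)) \<in> tuple_rel C x0" for m
        using \<tau>0 \<tau>n \<tau> \<open>0 < n\<close> by (intro vertex_tuple_subdivision loop \<sigma>F)
      have tuples: "z \<in> tuples C x0 n" if "(vertex_tuple \<delta>, (n, z)) \<in> tuple_rel C x0" "\<delta> \<in> ?F" for \<delta> z
        using tuple_rel_thin_homotopic(1)[OF _ vertex_tuple_in_tuples[OF loop[OF that(2)]]] that(1) by simp
      have xW: "?x \<in> ?W"
        using tuples[OF x \<gamma>F] tuple_class_eq[OF x] \<gamma> by (simp add: A_def)
      have "limitin (product_topology (\<lambda>_. top_of_set (\<Union>C)) {..n}) ?y ?x sequentially"
        unfolding limitin_componentwise
      proof (intro conjI ballI)
        show "?x \<in> extensional {..n}"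
          by simp
        have "?y m \<in> topspace (product_topology (\<lambda>_. top_of_set (\<Union>C)) {..n})" for m
          using tuples[OF y \<sigma>F, of m] by (simp add: tuples_def)
        then show "\<forall>\<^sub>F m in sequentially. ?y m \<in> topspace (product_topology (\<lambda>_. top_of_set (\<Union>C)) {..n})"
          by (intro always_eventually allI)
        fix i assume i: "i \<in> {..n}"
        have "\<gamma> (l i) \<in> \<Union>C" "\<sigma> (r m) (\<tau> (r m) i) \<in> \<Union>C" for m
          using loop[OF \<gamma>F] loop[OF \<sigma>F[of "r m"]] l01[of i] \<tau>01[of "r m" i] by (auto simp: pl_loops_def simp del: Union_iff)
        then show "limitin (top_of_set (\<Union>C)) (\<lambda>m. ?y m i) (?x i) sequentially"
          using vertex_lim[of i] i by (simp add: limitin_subtopology del: Union_iff)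
      qed
      moreover have "\<forall>\<^sub>F m in sequentially. ?y m \<in> tuples C x0 n"
        using tuples[OF y \<sigma>F] by (intro always_eventually allI)
      ultimately have "limitin (tuple_space C x0 n) ?y ?x sequentially"
        unfolding tuple_space_def using tuples[OF x \<gamma>F] by (simp only: limitin_subtopology simp_thms)
      then have "\<forall>\<^sub>F m in sequentially. ?y m \<in> ?W"
        using V xW unfolding limitin_def by blast
      then obtain m where "?y m \<in> ?W"
        using eventually_happens'[OF sequentially_bot] by blast
      then have "\<sigma> (r m) \<in> A"
        using tuple_class_eq[OF y] \<sigma>F by (simp add: A_def)
      then show False
        using \<sigma>(2) by blast
    qed
  qed
  moreover have "mtopology_of ?m = M.mtopology"
    by (simp only: mtopology_of_def)
  then have "M.mtopology = pl_filt_topology C x0 n"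
    by (simp only: pl_filt_topology_def mtopology_of_submetric)
  ultimately show ?thesis
    by (simp add: A_def)
qed

section \<open>The homeomorphism\<close>

abbreviation thin_rel :: "((real \<Rightarrow> 'a) \<times> (real \<Rightarrow> 'a)) set" where
  "thin_rel \<equiv> {(f, g). thin_homotopic C x0 f g}"

lemma thin_class_eq: "thin_homotopic C x0 f g \<Longrightarrow> thin_rel `` {f} = thin_rel `` {g}"
  using thin_homotopic_sym thin_homotopic_trans by blast

text \<open>The maps between the quotients. The images of the members of a class are all equivalent, so the union
  of their classes is a single class.\<close>

definition polygon_class :: "(nat \<times> (nat \<Rightarrow> 'a)) set \<Rightarrow> (real \<Rightarrow> 'a) set" where
  "polygon_class c = thin_rel `` (case_prod polygon ` c)"

definition vertex_class :: "(real \<Rightarrow> 'a) set \<Rightarrow> (nat \<times> (nat \<Rightarrow> 'a)) set" where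
  "vertex_class d = tuple_rel C x0 `` (vertex_tuple ` d)"

lemma polygon_class_eq:
  assumes "x \<in> tuples C x0 k"
  shows "polygon_class (tuple_rel C x0 `` {(k, x)}) = thin_rel `` {polygon k x}"
proof -
  have "thin_rel `` {case_prod polygon q} = thin_rel `` {polygon k x}" if "((k, x), q) \<in> tuple_rel C x0" for q
    using tuple_rel_thin_homotopic(2)[of k x "fst q" "snd q"] assms that thin_class_eq
    by (simp add: case_prod_unfold)
  moreover have "((k, x), (k, x)) \<in> tuple_rel C x0"
    by (rule tuple_rel_refl)
  ultimately have "(\<Union>q\<in>tuple_rel C x0 `` {(k, x)}. thin_rel `` {case_prod polygon q}) =
      thin_rel `` {polygon k x}"
    by (intro UN_constant_eq[of "(k, x)"]) auto
  then show ?thesis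
    unfolding polygon_class_def by blast
qed

lemma vertex_class_eq:
  assumes "\<gamma> \<in> pl_loops C x0"
  shows "vertex_class (thin_rel `` {\<gamma>}) = tuple_rel C x0 `` {vertex_tuple \<gamma>}"
proof -
  have "tuple_rel C x0 `` {vertex_tuple g} = tuple_rel C x0 `` {vertex_tuple \<gamma>}" if "thin_homotopic C x0 \<gamma> g" for g
    using tuple_class_eq[OF vertex_tuple_respects[OF that]] by simp
  moreover have "thin_homotopic C x0 \<gamma> \<gamma>"
    using assms by (rule thin_homotopic_refl)
  ultimately have "(\<Union>g\<in>thin_rel `` {\<gamma>}. tuple_rel C x0 `` {vertex_tuple g}) =
      tuple_rel C x0 `` {vertex_tuple \<gamma>}"
    by (intro UN_constant_eq[of \<gamma>]) blast+
  then show ?thesis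
    unfolding vertex_class_def by blast
qed

lemma topspace_omega_space: "topspace (omega_space C x0) = pl_loops C x0 // thin_rel"
  by (simp add: omega_space_def)

lemma continuous_map_polygon_class:
  "continuous_map (S_space C x0) (omega_space C x0) polygon_class"
  unfolding continuous_map
proof (intro conjI allI impI)
  show "polygon_class ` topspace (S_space C x0) \<subseteq> topspace (omega_space C x0)"
  proof
    fix d assume "d \<in> polygon_class ` topspace (S_space C x0)"
    then obtain k x where "x \<in> tuples C x0 k" "d = polygon_class (tuple_rel C x0 `` {(k, x)})"
      by (auto simp: topspace_S_space quotient_def)
    then show "d \<in> topspace (omega_space C x0)"
      using polygon_class_eq polygon_in_pl_loops by (auto simp: topspace_omega_space quotient_def)
  qed
next
  fix U assume U: "openin (omega_space C x0) U"
  define L where "L = {\<gamma> \<in> pl_loops C x0. thin_rel `` {\<gamma>} \<in> U}"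
  have "openin (weak_pl_loops C x0) L"
    using U by (simp add: omega_space_def openin_quotient_topology L_def)
  then have L: "openin (pl_filt_topology C x0 n) (L \<inter> pl_loops_filt C x0 n)" for n
    by (simp add: weak_pl_loops_def openin_colimit_topology)
  let ?P = "{c \<in> topspace (S_space C x0). polygon_class c \<in> U}"
  have "openin (S_filt C x0 n) (?P \<inter> topspace (S_filt C x0 n))" for n
  proof -
    let ?T = "{p \<in> topspace (sum_topology (tuple_space C x0) {..n}).
        tuple_rel C x0 `` {p} \<in> ?P \<inter> topspace (S_filt C x0 n)}"
    have "openin (tuple_space C x0 k) {x. (k, x) \<in> ?T}" if "k \<le> n" for k
    proof -
      have "tuple_rel C x0 `` {(k, x)} \<in> topspace (S_space C x0) \<inter> topspace (S_filt C x0 n)"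
        if "x \<in> tuples C x0 k" for x
        using that \<open>k \<le> n\<close> by (auto simp: topspace_S_space S_filt_def intro!: quotientI)
      then have "(k, x) \<in> ?T \<longleftrightarrow> x \<in> tuples C x0 k \<and> thin_rel `` {polygon k x} \<in> U" for x
        using \<open>k \<le> n\<close> polygon_class_eq[of x k] by auto
      then have "{x. (k, x) \<in> ?T} = {x \<in> topspace (tuple_space C x0 k). polygon k x \<in> L \<inter> pl_loops_filt C x0 (max 1 k)}"
        using polygon_in_filt polygon_in_pl_loops unfolding L_def topspace_tuple_space by blast
      then show ?thesis
        using openin_continuous_map_preimage[OF continuous_map_polygon L] by simp
    qed
    moreover have "?T \<subseteq> Sigma {..n} (topspace \<circ> tuple_space C x0)"
      by auto
    ultimately have "openin (sum_topology (tuple_space C x0) {..n}) ?T"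
      unfolding openin_sum_topology by blast
    moreover have "?P \<inter> topspace (S_filt C x0 n) \<subseteq>
        topspace (sum_topology (tuple_space C x0) {..n}) // tuple_rel C x0"
      by (simp add: S_filt_def)
    ultimately show ?thesis
      unfolding S_filt_def openin_quotient_topology by blast
  qed
  moreover have "?P \<subseteq> (\<Union>n. topspace (S_filt C x0 n))"
    using topspace_colimit_topology[of "S_filt C x0" "\<Union>n. topspace (S_filt C x0 n)"]
    by (auto simp: S_space_def)
  ultimately show "openin (S_space C x0) ?P"
    unfolding S_space_def openin_colimit_topology by blast
qed

lemma continuous_map_vertex_class:
  "continuous_map (omega_space C x0) (S_space C x0) vertex_class"
  unfolding continuous_map
proof (intro conjI allI impI)
  show "vertex_class ` topspace (omega_space C x0) \<subseteq> topspace (S_space C x0)"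
  proof
    fix c assume "c \<in> vertex_class ` topspace (omega_space C x0)"
    then obtain \<gamma> where \<gamma>: "\<gamma> \<in> pl_loops C x0" "c = vertex_class (thin_rel `` {\<gamma>})"
      by (auto simp: topspace_omega_space quotient_def)
    then have "vertex_tuple \<gamma> \<in> (SIGMA k:UNIV. tuples C x0 k)"
      using vertex_tuple_in_tuples by (cases "vertex_tuple \<gamma>") force
    then show "c \<in> topspace (S_space C x0)"
      using \<gamma> vertex_class_eq by (auto simp: topspace_S_space intro: quotientI)
  qed
next
  fix V assume V: "openin (S_space C x0) V"
  have W: "openin (tuple_space C x0 n) {x \<in> tuples C x0 n. tuple_rel C x0 `` {(n, x)} \<in> V}" for n
  proof -
    let ?T = "{p \<in> topspace (sum_topology (tuple_space C x0) {..n}).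
        tuple_rel C x0 `` {p} \<in> V \<inter> topspace (S_filt C x0 n)}"
    have "openin (S_filt C x0 n) (V \<inter> topspace (S_filt C x0 n))"
      using V by (simp add: S_space_def openin_colimit_topology)
    then have "openin (sum_topology (tuple_space C x0) {..n}) ?T"
      unfolding S_filt_def openin_quotient_topology by blast
    then have "openin (tuple_space C x0 n) {x. (n, x) \<in> ?T}"
      unfolding openin_sum_topology by blast
    moreover have "{x. (n, x) \<in> ?T} = {x \<in> tuples C x0 n. tuple_rel C x0 `` {(n, x)} \<in> V}"
      by (auto simp: S_filt_def quotient_def)
    ultimately show ?thesis by simp
  qed
  let ?Q = "{d \<in> topspace (omega_space C x0). vertex_class d \<in> V}"
  have Q: "{\<gamma> \<in> pl_loops C x0. thin_rel `` {\<gamma>} \<in> ?Q} =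
      {\<gamma> \<in> pl_loops C x0. tuple_rel C x0 `` {vertex_tuple \<gamma>} \<in> V}"
    unfolding topspace_omega_space using vertex_class_eq quotientI[of _ "pl_loops C x0" thin_rel] by auto
  have "openin (pl_filt_topology C x0 n)
      ({\<gamma> \<in> pl_loops C x0. tuple_rel C x0 `` {vertex_tuple \<gamma>} \<in> V} \<inter> topspace (pl_filt_topology C x0 n))" for n
  proof -
    have "{\<gamma> \<in> pl_loops C x0. tuple_rel C x0 `` {vertex_tuple \<gamma>} \<in> V} \<inter> topspace (pl_filt_topology C x0 n) =
        {\<gamma> \<in> pl_loops_filt C x0 n. tuple_rel C x0 `` {vertex_tuple \<gamma>} \<in> V}"
      by (auto simp: pl_loops_filt_def)
    then show ?thesis
      using openin_vertex_tuple_preimage[OF W] by simp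
  qed
  then have "openin (weak_pl_loops C x0) {\<gamma> \<in> pl_loops C x0. thin_rel `` {\<gamma>} \<in> ?Q}"
    unfolding Q weak_pl_loops_def openin_colimit_topology by blast
  moreover have "?Q \<subseteq> pl_loops C x0 // thin_rel"
    by (auto simp: topspace_omega_space)
  ultimately show "openin (omega_space C x0) ?Q"
    by (simp add: omega_space_def openin_quotient_topology)
qed

theorem S_space_homeomorphic_omega_space: "S_space C x0 homeomorphic_space omega_space C x0"
  unfolding homeomorphic_space_def homeomorphic_maps_def
proof (intro exI conjI ballI)
  show "continuous_map (S_space C x0) (omega_space C x0) polygon_class"
    by (rule continuous_map_polygon_class)
  show "continuous_map (omega_space C x0) (S_space C x0) vertex_class"
    by (rule continuous_map_vertex_class)
  show "vertex_class (polygon_class c) = c" if "c \<in> topspace (S_space C x0)" for c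
  proof -
    obtain k x where x: "x \<in> tuples C x0 k" and c: "c = tuple_rel C x0 `` {(k, x)}"
      using \<open>c \<in> topspace (S_space C x0)\<close> by (auto simp: topspace_S_space quotient_def)
    then show ?thesis
      using polygon_class_eq[OF x] vertex_class_eq[OF polygon_in_pl_loops[OF x]]
        tuple_class_eq[OF vertex_tuple_polygon[OF x]] by simp
  qed
  show "polygon_class (vertex_class d) = d" if "d \<in> topspace (omega_space C x0)" for d
  proof -
    obtain \<gamma> where \<gamma>: "\<gamma> \<in> pl_loops C x0" and d: "d = thin_rel `` {\<gamma>}"
      using \<open>d \<in> topspace (omega_space C x0)\<close> by (auto simp: topspace_omega_space quotient_def)
    then show ?thesis
      using vertex_class_eq[OF \<gamma>] polygon_class_eq[OF vertex_tuple_in_tuples[OF \<gamma>]]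
        thin_class_eq[OF polygon_vertex_tuple[OF \<gamma>]] by (simp add: case_prod_unfold)
  qed
qed

end

theorem theorem5p3:
  fixes C :: "'a::euclidean_space set set" and x0 :: 'a
  assumes "simplicial_complex C"
    and "connected (\<Union>C)"
    and "x0 \<in> \<Union>C"
  shows "S_space C x0 homeomorphic_space omega_space C x0"
proof -
  interpret convex_cover C x0
  proof
    show "finite C" and "x0 \<in> \<Union>C"
      using assms by (auto simp: simplicial_complex_def)
    fix S assume "S \<in> C"
    then obtain n where "n simplex S"
      using assms(1) by (auto simp: simplicial_complex_def)
    then show "closed S" "convex S"
      using simplex_imp_polytope polytope_imp_closed polytope_imp_convex by blast+
  qed
  show ?thesis
    by (rule S_space_homeomorphic_omega_space)
qed

end
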